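(* Let $(M,\varphi,\xi,\eta,g)$ be a regular $f$-Kenmotsu manifold. If $(M,g)$ is Ricci-semisymmetric (in particular, if it is semisymmetric), then $(M,g)$ is an Einstein manifold, i.e. its Ricci tensor satisfies $S=c\,g$ for some real constant $c$.
   Context: All objects are $C^\infty$; manifolds are connected. An almost contact metric manifold is a $(2n+1)$-dimensional manifold $M$ ($n\ge 1$) with a $(1,1)$-tensor field $\varphi$, a vector field $\xi$, a 1-form $\eta$ and a Riemannian metric $g$ such that $\varphi^2=-I+\eta\otimes\xi$, $\eta(\xi)=1$, $\eta\circ\varphi=0$, $\varphi(\xi)=0$, $\eta(X)=g(X,\xi)$ and $g(\varphi X,\varphi Y)=g(X,Y)-\eta(X)\eta(Y)$ for all vector fields $X,Y$. It is an $f$-Kenmotsu manifold if its Levi-Civita connection $\nabla$ satisfies $(\nabla_X\varphi)(Y)=f\,(g(\varphi X,Y)\xi-\varphi(X)\eta(Y))$ for all $X,Y$, where $f\in C^\infty(M)$ is strictly positive and $df\wedge\eta=0$. An $f$-Kenmotsu manifold is regular if $f^2+\xi(f)\neq 0$ at every point of $M$. Let $R$ be the curvature tensor and $S$ the Ricci tensor of $g$. The manifold is Ricci-semisymmetric if $R\cdot S=0$, where $(R(X,Y)\cdot S)(X_1,X_2)=-S(R(X,Y)X_1,X_2)-S(X_1,R(X,Y)X_2)$. It is semisymmetric if $R\cdot R=0$, where $R(X,Y)$ acts as a derivation on the tensor field $R$. Every semisymmetric manifold is Ricci-semisymmetric. *)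

theory Defs
  imports "HOL-Analysis.Analysis"
begin

text \<open>
  Manifolds are topological spaces with a smooth atlas modelled on a Euclidean space \<open>'v\<close>.
  A tensor field is given by its local representatives, one for each chart of the atlas, which are
  functions of the coordinates \<open>x\<close> and are related by the Jacobians of the changes of
  coordinates.  Tangent vectors at the point with coordinates \<open>x\<close> are represented by vectors
  in \<open>'v\<close>.  Local representatives carry no information outside the image of their chart.
\<close>

text \<open>
  Both notions are meant for open sets \<open>S\<close>.  In finite dimension the directional derivatives
  suffice to control the Frechet derivative.
\<close>

primrec Ck_on :: "nat \<Rightarrow> ('a::real_normed_vector \<Rightarrow> 'b::real_normed_vector) \<Rightarrow> 'a set \<Rightarrow> bool" where
  "Ck_on 0 f S \<longleftrightarrow> continuous_on S f"
| "Ck_on (Suc k) f S \<longleftrightarrow>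
     (\<forall>x\<in>S. f differentiable (at x)) \<and> (\<forall>h. Ck_on k (\<lambda>x. frechet_derivative f (at x) h) S)"

definition smooth_on :: "('a::real_normed_vector \<Rightarrow> 'b::real_normed_vector) \<Rightarrow> 'a set \<Rightarrow> bool" where
  "smooth_on f S \<longleftrightarrow> (\<forall>k. Ck_on k f S)"

type_synonym ('a, 'v) chart = "'a set \<times> ('a \<Rightarrow> 'v)"

definition chart_dom :: "('a, 'v) chart \<Rightarrow> 'a set" where
  "chart_dom c = fst c"

definition chart_map :: "('a, 'v) chart \<Rightarrow> 'a \<Rightarrow> 'v" where
  "chart_map c = snd c"

definition chart_image :: "('a, 'v) chart \<Rightarrow> 'v set" where
  "chart_image c = chart_map c ` chart_dom c"

definition chart_inv :: "('a, 'v) chart \<Rightarrow> 'v \<Rightarrow> 'a" where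
  "chart_inv c = inv_into (chart_dom c) (chart_map c)"

definition is_chart :: "'a topology \<Rightarrow> ('a, 'v::euclidean_space) chart \<Rightarrow> bool" where
  "is_chart M c \<longleftrightarrow>
     openin M (chart_dom c) \<and> open (chart_image c) \<and>
     homeomorphic_map (subtopology M (chart_dom c)) (top_of_set (chart_image c)) (chart_map c)"

definition chart_change :: "('a, 'v) chart \<Rightarrow> ('a, 'v) chart \<Rightarrow> 'v \<Rightarrow> 'v" where
  "chart_change c d = chart_map d \<circ> chart_inv c"

definition jacobian ::
  "('a, 'v::euclidean_space) chart \<Rightarrow> ('a, 'v) chart \<Rightarrow> 'a \<Rightarrow> 'v \<Rightarrow> 'v" where
  "jacobian c d p = frechet_derivative (chart_change c d) (at (chart_map c p))"

locale smooth_manifold =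
  fixes M :: "'a topology" and A :: "('a, 'v::euclidean_space) chart set"
  assumes Hausdorff: "Hausdorff_space M"
    and second_countable: "second_countable M"
    and connected: "connected_space M"
    and charts: "\<And>c. c \<in> A \<Longrightarrow> is_chart M c"
    and cover: "topspace M = (\<Union>c\<in>A. chart_dom c)"
    and smooth_compatible: "\<And>c d. c \<in> A \<Longrightarrow> d \<in> A \<Longrightarrow>
          smooth_on (chart_change c d) (chart_map c ` (chart_dom c \<inter> chart_dom d))"

definition local_rep :: "('a \<Rightarrow> real) \<Rightarrow> ('a, 'v) chart \<Rightarrow> 'v \<Rightarrow> real" where
  "local_rep f c = f \<circ> chart_inv c"

definition smooth_function :: "('a, 'v::euclidean_space) chart set \<Rightarrow> ('a \<Rightarrow> real) \<Rightarrow> bool" where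
  "smooth_function A f \<longleftrightarrow> (\<forall>c\<in>A. smooth_on (local_rep f c) (chart_image c))"

definition vector_field ::
  "('a, 'v::euclidean_space) chart set \<Rightarrow> (('a, 'v) chart \<Rightarrow> 'v \<Rightarrow> 'v) \<Rightarrow> bool" where
  "vector_field A X \<longleftrightarrow>
     (\<forall>c\<in>A. smooth_on (X c) (chart_image c)) \<and>
     (\<forall>c\<in>A. \<forall>d\<in>A. \<forall>p \<in> chart_dom c \<inter> chart_dom d.
        X d (chart_map d p) = jacobian c d p (X c (chart_map c p)))"

definition one_form ::
  "('a, 'v::euclidean_space) chart set \<Rightarrow> (('a, 'v) chart \<Rightarrow> 'v \<Rightarrow> 'v \<Rightarrow> real) \<Rightarrow> bool" where
  "one_form A \<omega> \<longleftrightarrow>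
     (\<forall>c\<in>A. (\<forall>x\<in>chart_image c. linear (\<omega> c x)) \<and>
        (\<forall>u. smooth_on (\<lambda>x. \<omega> c x u) (chart_image c))) \<and>
     (\<forall>c\<in>A. \<forall>d\<in>A. \<forall>p \<in> chart_dom c \<inter> chart_dom d. \<forall>u.
        \<omega> d (chart_map d p) (jacobian c d p u) = \<omega> c (chart_map c p) u)"

definition endomorphism_field ::
  "('a, 'v::euclidean_space) chart set \<Rightarrow> (('a, 'v) chart \<Rightarrow> 'v \<Rightarrow> 'v \<Rightarrow> 'v) \<Rightarrow> bool" where
  "endomorphism_field A F \<longleftrightarrow>
     (\<forall>c\<in>A. (\<forall>x\<in>chart_image c. linear (F c x)) \<and>
        (\<forall>u. smooth_on (\<lambda>x. F c x u) (chart_image c))) \<and>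
     (\<forall>c\<in>A. \<forall>d\<in>A. \<forall>p \<in> chart_dom c \<inter> chart_dom d. \<forall>u.
        F d (chart_map d p) (jacobian c d p u) = jacobian c d p (F c (chart_map c p) u))"

definition riemannian_metric ::
  "('a, 'v::euclidean_space) chart set \<Rightarrow> (('a, 'v) chart \<Rightarrow> 'v \<Rightarrow> 'v \<Rightarrow> 'v \<Rightarrow> real) \<Rightarrow> bool" where
  "riemannian_metric A g \<longleftrightarrow>
     (\<forall>c\<in>A. (\<forall>x\<in>chart_image c. bilinear (g c x) \<and> (\<forall>u v. g c x u v = g c x v u) \<and>
                 (\<forall>u. u \<noteq> 0 \<longrightarrow> g c x u u > 0)) \<and>
        (\<forall>u v. smooth_on (\<lambda>x. g c x u v) (chart_image c))) \<and>
     (\<forall>c\<in>A. \<forall>d\<in>A. \<forall>p \<in> chart_dom c \<inter> chart_dom d. \<forall>u v.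
        g d (chart_map d p) (jacobian c d p u) (jacobian c d p v) = g c (chart_map c p) u v)"

definition deriv_along :: "('v::euclidean_space \<Rightarrow> 'v) \<Rightarrow> ('v \<Rightarrow> real) \<Rightarrow> 'v \<Rightarrow> real" where
  "deriv_along X f x = frechet_derivative f (at x) (X x)"

definition lie_bracket ::
  "('v::euclidean_space \<Rightarrow> 'v) \<Rightarrow> ('v \<Rightarrow> 'v) \<Rightarrow> 'v \<Rightarrow> 'v" where
  "lie_bracket X Y x = frechet_derivative Y (at x) (X x) - frechet_derivative X (at x) (Y x)"

text \<open>
  The Levi-Civita connection of a metric \<open>G\<close> on an open set \<open>U\<close> of coordinates, as an operator on
  the smooth vector fields on \<open>U\<close>: the (unique) torsion-free metric connection.  A connection
  on a manifold is given below by its restrictions to the domains of the charts.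
\<close>

definition levi_civita_on ::
  "'v::euclidean_space set \<Rightarrow> ('v \<Rightarrow> 'v \<Rightarrow> 'v \<Rightarrow> real) \<Rightarrow>
   (('v \<Rightarrow> 'v) \<Rightarrow> ('v \<Rightarrow> 'v) \<Rightarrow> 'v \<Rightarrow> 'v) \<Rightarrow> bool" where
  "levi_civita_on U G D \<longleftrightarrow>
     (\<forall>X Y. smooth_on X U \<longrightarrow> smooth_on Y U \<longrightarrow>
        smooth_on (D X Y) U \<and>
        (\<forall>x\<in>U. D X Y x - D Y X x = lie_bracket X Y x)) \<and>
     (\<forall>X Y Z. smooth_on X U \<longrightarrow> smooth_on Y U \<longrightarrow> smooth_on Z U \<longrightarrow>
        (\<forall>x\<in>U. D (\<lambda>y. X y + Y y) Z x = D X Z x + D Y Z x \<and>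
               D Z (\<lambda>y. X y + Y y) x = D Z X x + D Z Y x \<and>
               deriv_along X (\<lambda>y. G y (Y y) (Z y)) x = G x (D X Y x) (Z x) + G x (Y x) (D X Z x))) \<and>
     (\<forall>h X Y. smooth_on h U \<longrightarrow> smooth_on X U \<longrightarrow> smooth_on Y U \<longrightarrow>
        (\<forall>x\<in>U. D (\<lambda>y. h y *\<^sub>R X y) Y x = h x *\<^sub>R D X Y x \<and>
               D X (\<lambda>y. h y *\<^sub>R Y y) x = h x *\<^sub>R D X Y x + deriv_along X h x *\<^sub>R Y x))"

definition curvature_operator ::
  "(('v::euclidean_space \<Rightarrow> 'v) \<Rightarrow> ('v \<Rightarrow> 'v) \<Rightarrow> 'v \<Rightarrow> 'v) \<Rightarrow>
   ('v \<Rightarrow> 'v) \<Rightarrow> ('v \<Rightarrow> 'v) \<Rightarrow> ('v \<Rightarrow> 'v) \<Rightarrow> 'v \<Rightarrow> 'v" where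
  "curvature_operator D X Y Z x = D X (D Y Z) x - D Y (D X Z) x - D (lie_bracket X Y) Z x"

text \<open>
  The value \<open>R(u,v)w\<close> of the curvature tensor on tangent vectors at \<open>x\<close> does not depend on how
  these are extended to vector fields; we extend them with constant components.
\<close>

definition curvature ::
  "(('v::euclidean_space \<Rightarrow> 'v) \<Rightarrow> ('v \<Rightarrow> 'v) \<Rightarrow> 'v \<Rightarrow> 'v) \<Rightarrow> 'v \<Rightarrow> 'v \<Rightarrow> 'v \<Rightarrow> 'v \<Rightarrow> 'v" where
  "curvature D x u v w = curvature_operator D (\<lambda>_. u) (\<lambda>_. v) (\<lambda>_. w) x"

text \<open>
  \<open>S(v,w)\<close> is the trace of \<open>u \<mapsto> R(u,v)w\<close>.  The trace of an endomorphism can be computed in any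
  basis; here it is the standard basis of \<open>'v\<close>, not an orthonormal basis for the metric.
\<close>

definition ricci ::
  "(('v::euclidean_space \<Rightarrow> 'v) \<Rightarrow> ('v \<Rightarrow> 'v) \<Rightarrow> 'v \<Rightarrow> 'v) \<Rightarrow> 'v \<Rightarrow> 'v \<Rightarrow> 'v \<Rightarrow> real" where
  "ricci D x v w = (\<Sum>b\<in>Basis. curvature D x b v w \<bullet> b)"

locale riemannian_manifold = smooth_manifold M A
  for M :: "'a topology" and A :: "('a, 'v::euclidean_space) chart set" +
  fixes g :: "('a, 'v) chart \<Rightarrow> 'v \<Rightarrow> 'v \<Rightarrow> 'v \<Rightarrow> real"
    and nabla :: "('a, 'v) chart \<Rightarrow> ('v \<Rightarrow> 'v) \<Rightarrow> ('v \<Rightarrow> 'v) \<Rightarrow> 'v \<Rightarrow> 'v"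
  assumes metric: "riemannian_metric A g"
    and levi_civita: "\<And>c. c \<in> A \<Longrightarrow> levi_civita_on (chart_image c) (g c) (nabla c)"

definition Ricci_semisymmetric ::
  "('a, 'v::euclidean_space) chart set \<Rightarrow>
   (('a, 'v) chart \<Rightarrow> ('v \<Rightarrow> 'v) \<Rightarrow> ('v \<Rightarrow> 'v) \<Rightarrow> 'v \<Rightarrow> 'v) \<Rightarrow> bool" where
  "Ricci_semisymmetric A nabla \<longleftrightarrow>
     (\<forall>c\<in>A. \<forall>x\<in>chart_image c. \<forall>u v w1 w2.
        let R = curvature (nabla c) x; S = ricci (nabla c) x
        in - S (R u v w1) w2 - S w1 (R u v w2) = 0)"

definition semisymmetric ::
  "('a, 'v::euclidean_space) chart set \<Rightarrow>
   (('a, 'v) chart \<Rightarrow> ('v \<Rightarrow> 'v) \<Rightarrow> ('v \<Rightarrow> 'v) \<Rightarrow> 'v \<Rightarrow> 'v) \<Rightarrow> bool" where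
  "semisymmetric A nabla \<longleftrightarrow>
     (\<forall>c\<in>A. \<forall>x\<in>chart_image c. \<forall>u v w1 w2 w3.
        let R = curvature (nabla c) x
        in R u v (R w1 w2 w3) - R (R u v w1) w2 w3 - R w1 (R u v w2) w3 - R w1 w2 (R u v w3) = 0)"

definition Einstein ::
  "('a, 'v::euclidean_space) chart set \<Rightarrow> (('a, 'v) chart \<Rightarrow> 'v \<Rightarrow> 'v \<Rightarrow> 'v \<Rightarrow> real) \<Rightarrow>
   (('a, 'v) chart \<Rightarrow> ('v \<Rightarrow> 'v) \<Rightarrow> ('v \<Rightarrow> 'v) \<Rightarrow> 'v \<Rightarrow> 'v) \<Rightarrow> bool" where
  "Einstein A g nabla \<longleftrightarrow>
     (\<exists>k::real. \<forall>c\<in>A. \<forall>x\<in>chart_image c. \<forall>u v. ricci (nabla c) x u v = k * g c x u v)"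

locale almost_contact_metric_manifold = riemannian_manifold M A g nabla
  for M :: "'a topology" and A :: "('a, 'v::euclidean_space) chart set" and g nabla +
  fixes n :: nat
    and \<phi> :: "('a, 'v) chart \<Rightarrow> 'v \<Rightarrow> 'v \<Rightarrow> 'v"
    and \<xi> :: "('a, 'v) chart \<Rightarrow> 'v \<Rightarrow> 'v"
    and \<eta> :: "('a, 'v) chart \<Rightarrow> 'v \<Rightarrow> 'v \<Rightarrow> real"
  assumes n_ge_1: "n \<ge> 1"
    and dimension: "DIM('v) = 2 * n + 1"
    and endomorphism_field_\<phi>: "endomorphism_field A \<phi>"
    and vector_field_\<xi>: "vector_field A \<xi>"
    and one_form_\<eta>: "one_form A \<eta>"
    and \<phi>_\<phi>: "\<And>c x u. c \<in> A \<Longrightarrow> x \<in> chart_image c \<Longrightarrow> \<phi> c x (\<phi> c x u) = - u + \<eta> c x u *\<^sub>R \<xi> c x"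
    and \<eta>_\<xi>: "\<And>c x. c \<in> A \<Longrightarrow> x \<in> chart_image c \<Longrightarrow> \<eta> c x (\<xi> c x) = 1"
    and \<eta>_\<phi>: "\<And>c x u. c \<in> A \<Longrightarrow> x \<in> chart_image c \<Longrightarrow> \<eta> c x (\<phi> c x u) = 0"
    and \<phi>_\<xi>: "\<And>c x. c \<in> A \<Longrightarrow> x \<in> chart_image c \<Longrightarrow> \<phi> c x (\<xi> c x) = 0"
    and \<eta>_eq: "\<And>c x u. c \<in> A \<Longrightarrow> x \<in> chart_image c \<Longrightarrow> \<eta> c x u = g c x u (\<xi> c x)"
    and g_\<phi>_\<phi>: "\<And>c x u v. c \<in> A \<Longrightarrow> x \<in> chart_image c \<Longrightarrow>
          g c x (\<phi> c x u) (\<phi> c x v) = g c x u v - \<eta> c x u * \<eta> c x v"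

text \<open>
  In \<open>Kenmotsu\<close> the left-hand side is \<open>(\<nabla>\<^sub>X \<phi>)(Y) = \<nabla>\<^sub>X (\<phi> Y) - \<phi> (\<nabla>\<^sub>X Y)\<close>, and \<open>df_wedge_\<eta>\<close> is
  \<open>df(u) \<eta>(v) - df(v) \<eta>(u) = 0\<close>.
\<close>

locale f_Kenmotsu_manifold = almost_contact_metric_manifold M A g nabla n \<phi> \<xi> \<eta>
  for M :: "'a topology" and A :: "('a, 'v::euclidean_space) chart set"
    and g nabla n \<phi> \<xi> \<eta> +
  fixes f :: "'a \<Rightarrow> real"
  assumes smooth_f: "smooth_function A f"
    and f_pos: "\<And>p. p \<in> topspace M \<Longrightarrow> f p > 0"
    and df_wedge_\<eta>: "\<And>c x u v. c \<in> A \<Longrightarrow> x \<in> chart_image c \<Longrightarrow>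
          frechet_derivative (local_rep f c) (at x) u * \<eta> c x v -
          frechet_derivative (local_rep f c) (at x) v * \<eta> c x u = 0"
    and Kenmotsu: "\<And>c X Y x. c \<in> A \<Longrightarrow> smooth_on X (chart_image c) \<Longrightarrow> smooth_on Y (chart_image c) \<Longrightarrow>
          x \<in> chart_image c \<Longrightarrow>
          nabla c X (\<lambda>y. \<phi> c y (Y y)) x - \<phi> c x (nabla c X Y x) =
          local_rep f c x *\<^sub>R
            (g c x (\<phi> c x (X x)) (Y x) *\<^sub>R \<xi> c x - \<eta> c x (Y x) *\<^sub>R \<phi> c x (X x))"

locale regular_f_Kenmotsu_manifold = f_Kenmotsu_manifold M A g nabla n \<phi> \<xi> \<eta> f
  for M :: "'a topology" and A :: "('a, 'v::euclidean_space) chart set"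
    and g nabla n \<phi> \<xi> \<eta> f +
  assumes regular: "\<And>c x. c \<in> A \<Longrightarrow> x \<in> chart_image c \<Longrightarrow>
          (local_rep f c x)\<^sup>2 + deriv_along (\<xi> c) (local_rep f c) x \<noteq> 0"

end

theory Submission
  imports Defs
begin

text \<open>
  From the structure equation, \<open>\<nabla>\<^sub>X \<xi> = f (X - \<eta>(X) \<xi>)\<close>, hence
  \<open>R(X,Y)\<xi> = \<lambda> (\<eta>(X) Y - \<eta>(Y) X)\<close> with \<open>\<lambda> = f\<^sup>2 + \<xi>(f)\<close>, and \<open>S(X,\<xi>) = -2n \<lambda> \<eta>(X)\<close>.  Since
  \<open>\<lambda> \<noteq> 0\<close>, evaluating \<open>(R(\<xi>,Y) \<cdot> S)(X,\<xi>) = 0\<close> gives \<open>S = -2n \<lambda> g\<close>.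

  To see that \<open>\<lambda>\<close> is constant, let \<open>Q\<close> be the difference of \<open>R\<close> and the curvature tensor of constant
  sectional curvature \<open>-\<lambda>\<close>.  It is trace free and vanishes as soon as one argument is \<open>\<xi>\<close>, so that
  \<open>(\<nabla>\<^sub>X Q)(Y,\<xi>)Z = f Q(X,Y)Z\<close>.  Tracing the second Bianchi identity for \<open>X, Y, \<xi>\<close> over \<open>X\<close> therefore
  involves the derivatives of \<open>\<lambda>\<close> only, and yields \<open>(2n-1) (Y(\<lambda>) \<eta>(Z) - \<xi>(\<lambda>) g(Y,Z)) = 0\<close>, whence
  \<open>d\<lambda> = 0\<close>.
\<close>

section \<open>Calculus of smooth functions\<close>

abbreviation dirderiv ::
  "'a::real_normed_vector \<Rightarrow> ('a \<Rightarrow> 'b::real_normed_vector) \<Rightarrow> 'a \<Rightarrow> 'b" where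
  "dirderiv h F x \<equiv> frechet_derivative F (at x) h"

lemma dirderiv_eq: "(F has_derivative F') (at x) \<Longrightarrow> dirderiv h F x = F' h"
  using frechet_derivative_at by metis

lemma frechet_derivative_worksI:
  "F differentiable (at x) \<Longrightarrow> (F has_derivative frechet_derivative F (at x)) (at x)"
  using frechet_derivative_works by blast

text \<open>The derivative at a point of an open set depends only on the values on that set. Local
  representatives carry no information outside their chart image, so rewriting under a derivative
  sign below goes through this lemma.\<close>

lemma dirderiv_cong:
  assumes "open S" "x \<in> S" "\<And>y. y \<in> S \<Longrightarrow> F y = H y"
  shows "frechet_derivative F (at x) = frechet_derivative H (at x)"
proof -
  have *: "(F has_derivative F') (at x) \<longleftrightarrow> (H has_derivative F') (at x)" for F'
    using has_derivative_transform_within_open[of F F' x UNIV S H]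
      has_derivative_transform_within_open[of H F' x UNIV S F] assms by auto
  show ?thesis unfolding frechet_derivative_def * ..
qed

lemma Ck_on_cong:
  assumes "open S" "\<And>x. x \<in> S \<Longrightarrow> F x = H x" "Ck_on k F S"
  shows "Ck_on k H S"
  using assms(2,3)
proof (induction k arbitrary: F H)
  case 0
  then show ?case using continuous_on_cong by (metis Ck_on.simps(1))
next
  case (Suc k)
  have "H differentiable (at x)" if "x \<in> S" for x
    using Suc.prems that \<open>open S\<close> has_derivative_transform_within_open
    unfolding differentiable_def Ck_on.simps by metis
  moreover have "Ck_on k (\<lambda>x. dirderiv h H x) S" for h
    using Suc.IH[of "\<lambda>x. dirderiv h F x" "\<lambda>x. dirderiv h H x"] Suc.prems
      dirderiv_cong[OF \<open>open S\<close>, of _ F H] by auto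
  ultimately show ?case by simp
qed

lemma Ck_on_Suc_D: "Ck_on (Suc k) F S \<Longrightarrow> Ck_on k F S"
proof (induction k arbitrary: F)
  case 0
  then show ?case
    by (simp add: differentiable_imp_continuous_within continuous_at_imp_continuous_on)
qed auto

lemma Ck_on_const: "Ck_on k (\<lambda>_. c) S"
  by (induction k arbitrary: c) simp_all

lemma Ck_on_bounded_linear:
  assumes "open S" "bounded_linear L" "Ck_on k F S"
  shows "Ck_on k (\<lambda>x. L (F x)) S"
  using assms(3)
proof (induction k arbitrary: F)
  case 0
  then show ?case using assms(2) by (simp add: bounded_linear.continuous_on)
next
  case (Suc k)
  have d: "((\<lambda>x. L (F x)) has_derivative (\<lambda>h. L (dirderiv h F x))) (at x)" if "x \<in> S" for x
    using Suc.prems that by (auto intro!: bounded_linear.has_derivative[OF assms(2)]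
        simp: frechet_derivative_worksI)
  have "Ck_on k (\<lambda>x. dirderiv h (\<lambda>x. L (F x)) x) S" for h
    by (rule Ck_on_cong[OF assms(1) _ Suc.IH[of "\<lambda>x. dirderiv h F x"]])
      (use Suc.prems dirderiv_eq[OF d] in auto)
  then show ?case using d by (auto intro: differentiableI)
qed

lemma Ck_on_add:
  assumes "open S" "Ck_on k F S" "Ck_on k H S"
  shows "Ck_on k (\<lambda>x. F x + H x) S"
  using assms(2,3)
proof (induction k arbitrary: F H)
  case 0
  then show ?case by (simp add: continuous_on_add)
next
  case (Suc k)
  have d: "((\<lambda>x. F x + H x) has_derivative (\<lambda>h. dirderiv h F x + dirderiv h H x)) (at x)"
    if "x \<in> S" for x
    using Suc.prems that by (auto intro!: has_derivative_add simp: frechet_derivative_worksI)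
  have "Ck_on k (\<lambda>x. dirderiv h (\<lambda>x. F x + H x) x) S" for h
    by (rule Ck_on_cong[OF assms(1) _ Suc.IH[of "\<lambda>x. dirderiv h F x" "\<lambda>x. dirderiv h H x"]])
      (use Suc.prems dirderiv_eq[OF d] in auto)
  then show ?case using d by (auto intro: differentiableI)
qed

lemma Ck_on_bilinear:
  assumes "open S" "bounded_bilinear B" "Ck_on k F S" "Ck_on k H S"
  shows "Ck_on k (\<lambda>x. B (F x) (H x)) S"
  using assms(3,4)
proof (induction k arbitrary: F H)
  case 0
  then show ?case using assms(2) by (simp add: bounded_bilinear.continuous_on)
next
  case (Suc k)
  have d: "((\<lambda>x. B (F x) (H x)) has_derivative
      (\<lambda>h. B (F x) (dirderiv h H x) + B (dirderiv h F x) (H x))) (at x)" if "x \<in> S" for x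
    using Suc.prems that by (auto intro!: bounded_bilinear.FDERIV[OF assms(2)]
        simp: frechet_derivative_worksI)
  have "Ck_on k (\<lambda>x. dirderiv h (\<lambda>x. B (F x) (H x)) x) S" for h
  proof (rule Ck_on_cong[OF assms(1)])
    \<comment> \<open>By the product rule each summand pairs one differentiated factor, of class
      \<open>k\<close>, with an undifferentiated one that has to be lowered from class
      \<open>Suc k\<close> to \<open>k\<close>.\<close>
    show "Ck_on k (\<lambda>x. B (F x) (dirderiv h H x) + B (dirderiv h F x) (H x)) S"
      using Suc.prems(1)[THEN Ck_on_Suc_D] Suc.prems(2)[THEN Ck_on_Suc_D] Suc.prems
      by (intro Ck_on_add[OF assms(1)] Suc.IH) simp_all
  qed (simp add: dirderiv_eq[OF d])
  then show ?case using d by (auto intro: differentiableI)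
qed

lemma smooth_on_cong:
  "open S \<Longrightarrow> (\<And>x. x \<in> S \<Longrightarrow> F x = H x) \<Longrightarrow> smooth_on F S \<Longrightarrow> smooth_on H S"
  unfolding smooth_on_def using Ck_on_cong by blast

lemma smooth_on_const: "smooth_on (\<lambda>_. c) S"
  unfolding smooth_on_def by (simp add: Ck_on_const)

lemma smooth_on_add:
  "open S \<Longrightarrow> smooth_on F S \<Longrightarrow> smooth_on H S \<Longrightarrow> smooth_on (\<lambda>x. F x + H x) S"
  unfolding smooth_on_def using Ck_on_add by blast

lemma smooth_on_bounded_linear:
  "open S \<Longrightarrow> bounded_linear L \<Longrightarrow> smooth_on F S \<Longrightarrow> smooth_on (\<lambda>x. L (F x)) S"
  unfolding smooth_on_def using Ck_on_bounded_linear by blast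

lemma smooth_on_bilinear:
  "open S \<Longrightarrow> bounded_bilinear B \<Longrightarrow> smooth_on F S \<Longrightarrow> smooth_on H S
    \<Longrightarrow> smooth_on (\<lambda>x. B (F x) (H x)) S"
  unfolding smooth_on_def using Ck_on_bilinear by blast

lemmas smooth_on_scaleR = smooth_on_bilinear[OF _ bounded_bilinear_scaleR]
  and smooth_on_mult = smooth_on_bilinear[OF _ bounded_bilinear_mult]
  and smooth_on_inner_const = smooth_on_bounded_linear[OF _ bounded_linear_inner_left]

lemma smooth_on_diff:
  "open S \<Longrightarrow> smooth_on F S \<Longrightarrow> smooth_on H S \<Longrightarrow> smooth_on (\<lambda>x. F x - H x) S"
  using smooth_on_add[of S F "\<lambda>x. - H x"]
    smooth_on_bounded_linear[OF _ bounded_linear_minus[OF bounded_linear_ident], of S H] by simp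

lemma smooth_on_sum:
  assumes "open S" "\<And>i. i \<in> I \<Longrightarrow> smooth_on (F i) S"
  shows "smooth_on (\<lambda>x. \<Sum>i\<in>I. F i x) S"
  using assms(2)
  by (induction I rule: infinite_finite_induct)
    (auto intro: smooth_on_const smooth_on_add[OF assms(1)])

lemma smooth_on_differentiable: "smooth_on F S \<Longrightarrow> x \<in> S \<Longrightarrow> F differentiable (at x)"
  unfolding smooth_on_def by (metis Ck_on.simps(2))

lemma smooth_on_has_derivative:
  "smooth_on F S \<Longrightarrow> x \<in> S \<Longrightarrow> (F has_derivative frechet_derivative F (at x)) (at x)"
  by (simp add: frechet_derivative_worksI smooth_on_differentiable)

lemma smooth_on_dirderiv: "smooth_on F S \<Longrightarrow> smooth_on (\<lambda>x. dirderiv h F x) S"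
  unfolding smooth_on_def by (metis Ck_on.simps(2))

lemma linear_dirderiv:
  "smooth_on F S \<Longrightarrow> x \<in> S \<Longrightarrow> linear (\<lambda>h. dirderiv h F x)"
  using linear_frechet_derivative smooth_on_differentiable by blast

lemma dirderiv_add:
  "smooth_on F S \<Longrightarrow> smooth_on H S \<Longrightarrow> x \<in> S \<Longrightarrow>
    dirderiv h (\<lambda>y. F y + H y) x = dirderiv h F x + dirderiv h H x"
  by (rule dirderiv_eq, rule has_derivative_add) (simp_all add: smooth_on_has_derivative)

lemma dirderiv_diff:
  "smooth_on F S \<Longrightarrow> smooth_on H S \<Longrightarrow> x \<in> S \<Longrightarrow>
    dirderiv h (\<lambda>y. F y - H y) x = dirderiv h F x - dirderiv h H x"
  by (rule dirderiv_eq, rule has_derivative_diff) (simp_all add: smooth_on_has_derivative)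

lemma dirderiv_scaleR:
  "smooth_on F S \<Longrightarrow> smooth_on H S \<Longrightarrow> x \<in> S \<Longrightarrow>
    dirderiv h (\<lambda>y. F y *\<^sub>R H y) x = F x *\<^sub>R dirderiv h H x + dirderiv h F x *\<^sub>R H x"
  by (rule dirderiv_eq, rule has_derivative_scaleR) (simp_all add: smooth_on_has_derivative)

lemma dirderiv_bounded_linear:
  "bounded_linear L \<Longrightarrow> smooth_on F S \<Longrightarrow> x \<in> S \<Longrightarrow>
    dirderiv h (\<lambda>y. L (F y)) x = L (dirderiv h F x)"
  by (rule dirderiv_eq, rule bounded_linear.has_derivative) (simp_all add: smooth_on_has_derivative)

lemma dirderiv_sum:
  "(\<And>i. i \<in> I \<Longrightarrow> smooth_on (F i) S) \<Longrightarrow> x \<in> S \<Longrightarrow>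
    dirderiv h (\<lambda>y. \<Sum>i\<in>I. F i y) x = (\<Sum>i\<in>I. dirderiv h (F i) x)"
  by (rule dirderiv_eq, rule has_derivative_sum, rule smooth_on_has_derivative)

section \<open>Fields of linear maps applied to vector fields\<close>

lemma linear_expand:
  fixes L :: "'v::euclidean_space \<Rightarrow> 'w::real_vector"
  assumes "linear L"
  shows "L v = (\<Sum>i\<in>Basis. (v \<bullet> i) *\<^sub>R L i)"
  using arg_cong[OF euclidean_representation[of v], of L]
  by (simp add: linear_sum[OF assms] linear_scale[OF assms])

text \<open>Tensor fields are known to be smooth only on fixed vectors. Expanding \<open>Y x\<close>
  in the standard basis gives a finite sum of products of smooth functions.\<close>

lemma smooth_on_linear_apply:
  fixes B :: "'v::euclidean_space \<Rightarrow> 'v \<Rightarrow> 'w::real_normed_vector"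
  assumes "open S" "\<And>x. x \<in> S \<Longrightarrow> linear (B x)" "\<And>u. smooth_on (\<lambda>x. B x u) S" "smooth_on Y S"
  shows "smooth_on (\<lambda>x. B x (Y x)) S"
proof (rule smooth_on_cong[OF assms(1)])
  show "smooth_on (\<lambda>x. \<Sum>i\<in>Basis. (Y x \<bullet> i) *\<^sub>R B x i) S"
    using assms by (intro smooth_on_sum smooth_on_scaleR smooth_on_inner_const) auto
qed (rule linear_expand[OF assms(2), symmetric])

text \<open>The Leibniz rule for a contraction: in the first term the argument is frozen at
  \<open>Y x\<close>, in the second the linear map is frozen at \<open>x\<close>.\<close>

lemma dirderiv_linear_apply:
  fixes B :: "'v::euclidean_space \<Rightarrow> 'v \<Rightarrow> 'w::real_normed_vector"
  assumes "open S" "\<And>x. x \<in> S \<Longrightarrow> linear (B x)" "\<And>u. smooth_on (\<lambda>x. B x u) S" "smooth_on Y S"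
    and "x \<in> S"
  shows "dirderiv h (\<lambda>y. B y (Y y)) x = dirderiv h (\<lambda>y. B y (Y x)) x + B x (dirderiv h Y x)"
proof -
  have s: "smooth_on (\<lambda>y. Y y \<bullet> i) S" for i
    using assms by (intro smooth_on_inner_const)
  have [simp]: "dirderiv h (\<lambda>y. c *\<^sub>R B y i) x = c *\<^sub>R dirderiv h (\<lambda>y. B y i) x" for c i
    using dirderiv_bounded_linear[OF bounded_linear_scaleR_right assms(3,5)] .
  have "dirderiv h (\<lambda>y. B y (Y y)) x = dirderiv h (\<lambda>y. \<Sum>i\<in>Basis. (Y y \<bullet> i) *\<^sub>R B y i) x"
    by (rule fun_cong[OF dirderiv_cong[OF assms(1,5)]], rule linear_expand[OF assms(2)])
  also have "\<dots> = (\<Sum>i\<in>Basis. (Y x \<bullet> i) *\<^sub>R dirderiv h (\<lambda>y. B y i) x + (dirderiv h Y x \<bullet> i) *\<^sub>R B x i)"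
    by (subst dirderiv_sum[where S=S])
      (auto intro!: sum.cong smooth_on_scaleR s assms
         simp: dirderiv_scaleR[OF s assms(3,5)]
           dirderiv_bounded_linear[OF bounded_linear_inner_left assms(4,5)])
  also have "\<dots> = dirderiv h (\<lambda>y. \<Sum>i\<in>Basis. (Y x \<bullet> i) *\<^sub>R B y i) x + B x (dirderiv h Y x)"
    by (subst dirderiv_sum[where S=S])
      (auto intro!: smooth_on_scaleR smooth_on_const assms
        simp: sum.distrib linear_expand[OF assms(2)[OF assms(5)], of "dirderiv h Y x"])
  also have "dirderiv h (\<lambda>y. \<Sum>i\<in>Basis. (Y x \<bullet> i) *\<^sub>R B y i) x = dirderiv h (\<lambda>y. B y (Y x)) x"
    by (rule fun_cong[OF dirderiv_cong[OF assms(1,5)]], rule linear_expand[OF assms(2), symmetric])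
  finally show ?thesis .
qed

section \<open>Symmetry of second derivatives\<close>

text \<open>The numerator is symmetric in \<open>a\<close> and \<open>b\<close>, so this limit
  yields Schwarz's theorem. The mean value theorem in direction \<open>a\<close> turns the second
  difference into a first difference of \<open>D\<close>, which is estimated by the
  differentiability of \<open>D\<close> at \<open>x\<close>.\<close>

lemma second_difference_tendsto:
  fixes F :: "'a::real_normed_vector \<Rightarrow> real"
  assumes "open S" "smooth_on F S" "x \<in> S"
  shows "((\<lambda>s. (F (x + s *\<^sub>R a + s *\<^sub>R b) - F (x + s *\<^sub>R a) - F (x + s *\<^sub>R b) + F x) / s\<^sup>2)
    \<longlongrightarrow> dirderiv b (\<lambda>y. dirderiv a F y) x) (at_right 0)"
proof (rule tendstoI)
  fix e :: real assume "e > 0"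
  define D where "D = (\<lambda>y. dirderiv a F y)"
  define D' where "D' = frechet_derivative D (at x)"
  \<comment> \<open>All displacements from \<open>x\<close> below have norm at most
    \<open>s * c\<close>; the summand 1 keeps \<open>c\<close> positive when \<open>a\<close> and
    \<open>b\<close> vanish.\<close>
  define c where "c = norm a + norm b + 1"
  have c: "c > 0" "norm a \<le> c" "norm a + norm b \<le> c"
    unfolding c_def by (auto intro: add_nonneg_pos)
  have D: "(D has_derivative D') (at x)"
    unfolding D_def D'_def
    by (rule smooth_on_has_derivative[OF smooth_on_dirderiv[OF assms(2)] assms(3)])
  interpret D': bounded_linear D' using D by (rule has_derivative_bounded_linear)
  \<comment> \<open>Two remainders of size at most \<open>e' * (s * c)\<close> will occur, together
    \<open>s * (e / 2)\<close>; this is strictly below \<open>s * e\<close>.\<close>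
  define e' where "e' = e / (4 * c)"
  have "e' > 0" using \<open>e > 0\<close> c by (simp add: e'_def)
  then obtain d where d: "d > 0"
      "\<And>y. norm (y - x) < d \<Longrightarrow> norm (D y - D x - D' (y - x)) \<le> e' * norm (y - x)"
    using D unfolding has_derivative_at_alt by metis
  obtain r where r: "r > 0" "ball x r \<subseteq> S" using assms openE by blast
  \<comment> \<open>For \<open>s < s0\<close> every displaced point lies both in \<open>S\<close>
    and in the range of the estimate for \<open>D\<close>.\<close>
  define s0 where "s0 = min d r / c"
  have "s0 > 0" using d r c by (simp add: s0_def)
  have "dist ((F (x + s *\<^sub>R a + s *\<^sub>R b) - F (x + s *\<^sub>R a) - F (x + s *\<^sub>R b) + F x) / s\<^sup>2) (D' b) < e"
    if s: "0 < s" "s < s0" for s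
  proof -
    have sc: "s * c < d" "s * c < r" using s c by (simp_all add: s0_def field_simps)
    have n1: "norm (t *\<^sub>R a + s *\<^sub>R b) \<le> s * c" "norm (t *\<^sub>R a) \<le> s * c" if "0 \<le> t" "t \<le> s" for t
    proof -
      have "norm (t *\<^sub>R a + s *\<^sub>R b) \<le> t * norm a + s * norm b"
        using norm_triangle_ineq[of "t *\<^sub>R a" "s *\<^sub>R b"] that s by simp
      also have "\<dots> \<le> s * norm a + s * norm b" using that by (simp add: mult_right_mono)
      also have "\<dots> \<le> s * c"
        using c(3) s by (simp add: distrib_left[symmetric])
      finally show "norm (t *\<^sub>R a + s *\<^sub>R b) \<le> s * c" .
      show "norm (t *\<^sub>R a) \<le> s * c" using that c s by (simp add: mult_mono)
    qed
    have inS: "x + t *\<^sub>R a + s *\<^sub>R b \<in> S" "x + t *\<^sub>R a \<in> S" if "0 \<le> t" "t \<le> s" for t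
    proof -
      have "norm (t *\<^sub>R a + s *\<^sub>R b) < r" "norm (t *\<^sub>R a) < r"
        using n1[OF that] sc by linarith+
      then have "x + (t *\<^sub>R a + s *\<^sub>R b) \<in> ball x r" "x + t *\<^sub>R a \<in> ball x r"
        by (simp_all add: dist_norm norm_minus_commute add.commute del: norm_scaleR)
      then show "x + t *\<^sub>R a + s *\<^sub>R b \<in> S" "x + t *\<^sub>R a \<in> S" using r by (auto simp: add.assoc)
    qed
    define \<psi> where "\<psi> t = F (x + t *\<^sub>R a + s *\<^sub>R b) - F (x + t *\<^sub>R a)" for t
    have slice: "((\<lambda>t. F (x + t *\<^sub>R a + w)) has_real_derivative D (x + t *\<^sub>R a + w)) (at t)"
      if "x + t *\<^sub>R a + w \<in> S" for t w
    proof -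
      let ?F' = "frechet_derivative F (at (x + t *\<^sub>R a + w))"
      have F': "(F has_derivative ?F') (at (x + t *\<^sub>R a + w))"
        by (rule smooth_on_has_derivative[OF assms(2) that])
      have "((\<lambda>t. x + t *\<^sub>R a + w) has_derivative (\<lambda>h. h *\<^sub>R a)) (at t)"
        by (auto intro!: derivative_eq_intros)
      then have "((\<lambda>t. F (x + t *\<^sub>R a + w)) has_derivative (\<lambda>h. ?F' (h *\<^sub>R a))) (at t)"
        using F' by (rule has_derivative_compose)
      moreover have "(\<lambda>h. ?F' (h *\<^sub>R a)) = (*) (D (x + t *\<^sub>R a + w))"
        using linear_scale[OF has_derivative_linear[OF F']] by (auto simp: D_def mult.commute)
      ultimately show ?thesis unfolding has_field_derivative_def by simp
    qed
    have "(\<psi> has_real_derivative D (x + t *\<^sub>R a + s *\<^sub>R b) - D (x + t *\<^sub>R a)) (at t)"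
      if "0 \<le> t" "t \<le> s" for t
      unfolding \<psi>_def using slice[of t "s *\<^sub>R b"] slice[of t 0] inS[OF that]
      by (auto intro: DERIV_diff)
    then obtain t where t: "0 < t" "t < s"
        "\<psi> s - \<psi> 0 = (s - 0) * (D (x + t *\<^sub>R a + s *\<^sub>R b) - D (x + t *\<^sub>R a))"
      using MVT2[OF s(1), of \<psi> "\<lambda>t. D (x + t *\<^sub>R a + s *\<^sub>R b) - D (x + t *\<^sub>R a)"] by blast
    let ?u = "t *\<^sub>R a + s *\<^sub>R b" and ?v = "t *\<^sub>R a"
    have nu: "norm ?u \<le> s * c" "norm ?v \<le> s * c" using n1[of t] t by auto
    \<comment> \<open>The intermediate point \<open>t\<close> of the mean value theorem is unknown,
      but its contribution to the linear parts cancels.\<close>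
    have lin: "D' ?u - D' ?v = s * D' b"
      by (simp add: D'.add D'.scaleR)
    have "norm (D (x + ?u) - D x - D' ?u) \<le> e' * norm ?u"
      using d(2)[of "x + ?u"] nu sc by simp
    moreover have "norm (D (x + ?v) - D x - D' ?v) \<le> e' * norm ?v"
      using d(2)[of "x + ?v"] nu sc by simp
    moreover have "e' * norm ?u \<le> e' * (s * c)" "e' * norm ?v \<le> e' * (s * c)"
      using nu \<open>e' > 0\<close> by (simp_all add: mult_left_mono del: norm_scaleR)
    ultimately have "\<bar>D (x + ?u) - D (x + ?v) - s * D' b\<bar> \<le> e' * (s * c) + e' * (s * c)"
      using lin unfolding real_norm_def by linarith
    also have "\<dots> = s * (e / 2)" using c by (simp add: e'_def field_simps)
    also have "\<dots> < s * e" using s \<open>e > 0\<close> by simp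
    finally have *: "\<bar>D (x + ?u) - D (x + ?v) - s * D' b\<bar> < s * e" .
    have "(F (x + s *\<^sub>R a + s *\<^sub>R b) - F (x + s *\<^sub>R a) - F (x + s *\<^sub>R b) + F x) = \<psi> s - \<psi> 0"
      by (simp add: \<psi>_def)
    also have "\<dots> = s * (D (x + ?u) - D (x + ?v))" using t(3) by (simp add: add.assoc)
    finally have E: "(F (x + s *\<^sub>R a + s *\<^sub>R b) - F (x + s *\<^sub>R a) - F (x + s *\<^sub>R b) + F x)
        = s * (D (x + ?u) - D (x + ?v))" .
    have E2: "(F (x + s *\<^sub>R a + s *\<^sub>R b) - F (x + s *\<^sub>R a) - F (x + s *\<^sub>R b) + F x) / s\<^sup>2 - D' b
        = (D (x + ?u) - D (x + ?v) - s * D' b) / s"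
      unfolding E using s by (simp add: power2_eq_square diff_divide_distrib)
    show ?thesis unfolding dist_real_def E2 using * s
      by (simp add: pos_divide_less_eq mult.commute)
  qed
  then show "eventually (\<lambda>s. dist ((F (x + s *\<^sub>R a + s *\<^sub>R b) - F (x + s *\<^sub>R a) - F (x + s *\<^sub>R b) + F x) / s\<^sup>2)
      (dirderiv b (\<lambda>y. dirderiv a F y) x) < e) (at_right 0)"
    unfolding eventually_at_right_field D'_def D_def using \<open>s0 > 0\<close> by blast
qed

lemma dirderiv_commute_real:
  fixes F :: "'a::real_normed_vector \<Rightarrow> real"
  assumes "open S" "smooth_on F S" "x \<in> S"
  shows "dirderiv a (\<lambda>y. dirderiv b F y) x = dirderiv b (\<lambda>y. dirderiv a F y) x"
  using second_difference_tendsto[OF assms, of a b] second_difference_tendsto[OF assms, of b a]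
  by (intro tendsto_unique[OF trivial_limit_at_right_real]) (simp_all add: algebra_simps)

lemma dirderiv_commute:
  fixes F :: "'a::real_normed_vector \<Rightarrow> 'b::euclidean_space"
  assumes "open S" "smooth_on F S" "x \<in> S"
  shows "dirderiv a (\<lambda>y. dirderiv b F y) x = dirderiv b (\<lambda>y. dirderiv a F y) x"
proof (rule euclidean_eqI)
  fix i :: 'b
  note L = bounded_linear_inner_left[of i]
  have *: "dirderiv u (\<lambda>y. dirderiv w (\<lambda>z. F z \<bullet> i) y) x = dirderiv u (\<lambda>y. dirderiv w F y) x \<bullet> i"
    for u w
  proof -
    have "dirderiv u (\<lambda>y. dirderiv w (\<lambda>z. F z \<bullet> i) y) x = dirderiv u (\<lambda>y. dirderiv w F y \<bullet> i) x"
      by (rule fun_cong[OF dirderiv_cong[OF assms(1,3)]])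
        (rule dirderiv_bounded_linear[OF L assms(2)])
    then show ?thesis
      using dirderiv_bounded_linear[OF L smooth_on_dirderiv[OF assms(2)] assms(3)] by simp
  qed
  show "dirderiv a (\<lambda>y. dirderiv b F y) x \<bullet> i = dirderiv b (\<lambda>y. dirderiv a F y) x \<bullet> i"
    using dirderiv_commute_real[OF assms(1) smooth_on_inner_const[OF assms(1,2), of i] assms(3), where a = a and b = b]
    by (simp add: *)
qed

section \<open>The Levi-Civita connection in a chart\<close>

text \<open>The setting of a single chart. Tensor identities are proved here with arguments of
  constant components, which serve as a commuting frame; only \<lambda> and its constancy need to be
  carried from chart to chart.\<close>

locale coordinate_metric =
  fixes U :: "'v::euclidean_space set"
    and G :: "'v \<Rightarrow> 'v \<Rightarrow> 'v \<Rightarrow> real"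
    and D :: "('v \<Rightarrow> 'v) \<Rightarrow> ('v \<Rightarrow> 'v) \<Rightarrow> 'v \<Rightarrow> 'v"
  assumes open_U: "open U"
    and G_bilinear: "\<And>x. x \<in> U \<Longrightarrow> bilinear (G x)"
    and G_sym: "\<And>x u v. x \<in> U \<Longrightarrow> G x u v = G x v u"
    and G_pos: "\<And>x u. x \<in> U \<Longrightarrow> u \<noteq> 0 \<Longrightarrow> G x u u > 0"
    and G_smooth: "\<And>u v. smooth_on (\<lambda>x. G x u v) U"
    and levi_civita_D: "levi_civita_on U G D"
begin

definition christoffel :: "'v \<Rightarrow> 'v \<Rightarrow> 'v \<Rightarrow> 'v" ("\<Gamma>") where
  "\<Gamma> x a b = D (\<lambda>_. a) (\<lambda>_. b) x"

abbreviation "K \<equiv> curvature D"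

abbreviation cov :: "'v \<Rightarrow> ('v \<Rightarrow> 'v) \<Rightarrow> 'v \<Rightarrow> 'v" where
  "cov a \<equiv> D (\<lambda>_. a)"

lemma D_smooth: "smooth_on X U \<Longrightarrow> smooth_on Y U \<Longrightarrow> smooth_on (D X Y) U"
  and D_torsion_free: "smooth_on X U \<Longrightarrow> smooth_on Y U \<Longrightarrow> x \<in> U \<Longrightarrow>
    D X Y x - D Y X x = lie_bracket X Y x"
  and D_add_left: "smooth_on X U \<Longrightarrow> smooth_on Y U \<Longrightarrow> smooth_on Z U \<Longrightarrow> x \<in> U \<Longrightarrow>
    D (\<lambda>y. X y + Y y) Z x = D X Z x + D Y Z x"
  and D_add_right: "smooth_on X U \<Longrightarrow> smooth_on Y U \<Longrightarrow> smooth_on Z U \<Longrightarrow> x \<in> U \<Longrightarrow>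
    D Z (\<lambda>y. X y + Y y) x = D Z X x + D Z Y x"
  and D_metric: "smooth_on X U \<Longrightarrow> smooth_on Y U \<Longrightarrow> smooth_on Z U \<Longrightarrow> x \<in> U \<Longrightarrow>
    deriv_along X (\<lambda>y. G y (Y y) (Z y)) x = G x (D X Y x) (Z x) + G x (Y x) (D X Z x)"
  and D_scale_left: "smooth_on h U \<Longrightarrow> smooth_on X U \<Longrightarrow> smooth_on Y U \<Longrightarrow> x \<in> U \<Longrightarrow>
    D (\<lambda>y. h y *\<^sub>R X y) Y x = h x *\<^sub>R D X Y x"
  and D_leibniz: "smooth_on h U \<Longrightarrow> smooth_on X U \<Longrightarrow> smooth_on Y U \<Longrightarrow> x \<in> U \<Longrightarrow>
    D X (\<lambda>y. h y *\<^sub>R Y y) x = h x *\<^sub>R D X Y x + deriv_along X h x *\<^sub>R Y x"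
proof -
  note lc = levi_civita_D[unfolded levi_civita_on_def]
  note lc1 = lc[THEN conjunct1, rule_format]
    and lc2 = lc[THEN conjunct2, THEN conjunct1, rule_format]
    and lc3 = lc[THEN conjunct2, THEN conjunct2, rule_format]
  show "smooth_on X U \<Longrightarrow> smooth_on Y U \<Longrightarrow> smooth_on (D X Y) U"
    by (rule lc1[THEN conjunct1])
  show "smooth_on X U \<Longrightarrow> smooth_on Y U \<Longrightarrow> x \<in> U \<Longrightarrow> D X Y x - D Y X x = lie_bracket X Y x"
    by (rule lc1[THEN conjunct2, rule_format])
  show "smooth_on X U \<Longrightarrow> smooth_on Y U \<Longrightarrow> smooth_on Z U \<Longrightarrow> x \<in> U \<Longrightarrow>
      D (\<lambda>y. X y + Y y) Z x = D X Z x + D Y Z x"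
    by (rule lc2[THEN conjunct1])
  show "smooth_on X U \<Longrightarrow> smooth_on Y U \<Longrightarrow> smooth_on Z U \<Longrightarrow> x \<in> U \<Longrightarrow>
      D Z (\<lambda>y. X y + Y y) x = D Z X x + D Z Y x"
    by (rule lc2[THEN conjunct2, THEN conjunct1])
  show "smooth_on X U \<Longrightarrow> smooth_on Y U \<Longrightarrow> smooth_on Z U \<Longrightarrow> x \<in> U \<Longrightarrow>
      deriv_along X (\<lambda>y. G y (Y y) (Z y)) x = G x (D X Y x) (Z x) + G x (Y x) (D X Z x)"
    by (rule lc2[THEN conjunct2, THEN conjunct2])
  show "smooth_on h U \<Longrightarrow> smooth_on X U \<Longrightarrow> smooth_on Y U \<Longrightarrow> x \<in> U \<Longrightarrow>
      D (\<lambda>y. h y *\<^sub>R X y) Y x = h x *\<^sub>R D X Y x"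
    by (rule lc3[THEN conjunct1])
  show "smooth_on h U \<Longrightarrow> smooth_on X U \<Longrightarrow> smooth_on Y U \<Longrightarrow> x \<in> U \<Longrightarrow>
      D X (\<lambda>y. h y *\<^sub>R Y y) x = h x *\<^sub>R D X Y x + deriv_along X h x *\<^sub>R Y x"
    by (rule lc3[THEN conjunct2])
qed

lemma G_linear: "x \<in> U \<Longrightarrow> linear (G x u)" "x \<in> U \<Longrightarrow> linear (\<lambda>u. G x u v)"
  using G_bilinear unfolding bilinear_def by auto

lemmas G_simps = linear_add[OF G_linear(1)] linear_add[OF G_linear(2)]
  linear_diff[OF G_linear(1)] linear_diff[OF G_linear(2)]
  linear_neg[OF G_linear(1)] linear_neg[OF G_linear(2)]
  linear_scale[OF G_linear(1)] linear_scale[OF G_linear(2)]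
  linear_0[OF G_linear(1)] linear_0[OF G_linear(2)]

lemma G_nondegenerate: "x \<in> U \<Longrightarrow> (\<And>v. G x u v = 0) \<Longrightarrow> u = 0"
  using G_pos[of x u] by (metis less_irrefl)

lemma smooth_G:
  assumes "smooth_on X U" "smooth_on Y U"
  shows "smooth_on (\<lambda>x. G x (X x) (Y x)) U"
proof (rule smooth_on_linear_apply[where B="\<lambda>x. G x (X x)", OF open_U G_linear(1) _ assms(2)])
  show "smooth_on (\<lambda>x. G x (X x) u) U" for u
    by (rule smooth_on_linear_apply[where B="\<lambda>x w. G x w u", OF open_U G_linear(2) G_smooth assms(1)])
qed

lemma D_sum_left:
  assumes "\<And>i. i \<in> I \<Longrightarrow> smooth_on (X i) U" "smooth_on Z U" "x \<in> U"
  shows "D (\<lambda>y. \<Sum>i\<in>I. X i y) Z x = (\<Sum>i\<in>I. D (X i) Z x)"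
proof -
  have 0: "D (\<lambda>_. 0) Z x = 0"
    using D_scale_left[of "\<lambda>_. 0" "\<lambda>_. 0" Z x] assms by (simp add: smooth_on_const)
  show ?thesis using assms(1)
  proof (induction I rule: infinite_finite_induct)
    case (insert i I)
    have s: "smooth_on (X i) U" "smooth_on (\<lambda>y. \<Sum>i\<in>I. X i y) U"
      by (intro smooth_on_sum open_U insert.prems; simp)+
    show ?case
      using insert.IH[OF insert.prems] insert.hyps D_add_left[OF s(1,2) assms(2,3)] by simp
  qed (simp_all add: 0)
qed

lemma D_sum_right:
  assumes "\<And>i. i \<in> I \<Longrightarrow> smooth_on (X i) U" "smooth_on Z U" "x \<in> U"
  shows "D Z (\<lambda>y. \<Sum>i\<in>I. X i y) x = (\<Sum>i\<in>I. D Z (X i) x)"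
proof -
  have 0: "D Z (\<lambda>_. 0) x = 0"
    using D_leibniz[of "\<lambda>_. 0" Z "\<lambda>_. 0" x] assms by (simp add: smooth_on_const deriv_along_def)
  show ?thesis using assms(1)
  proof (induction I rule: infinite_finite_induct)
    case (insert i I)
    have s: "smooth_on (X i) U" "smooth_on (\<lambda>y. \<Sum>i\<in>I. X i y) U"
      by (intro smooth_on_sum open_U insert.prems; simp)+
    show ?case
      using insert.IH[OF insert.prems] insert.hyps D_add_right[OF s(1,2) assms(2,3)] by simp
  qed (simp_all add: 0)
qed

lemma christoffel_linear:
  assumes "x \<in> U" shows "linear (\<Gamma> x a)" "linear (\<lambda>a. \<Gamma> x a b)"
  using D_add_right[of "\<lambda>_. u" "\<lambda>_. v" "\<lambda>_. a" x for u v] D_add_left[of "\<lambda>_. u" "\<lambda>_. v" "\<lambda>_. b" x for u v]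
    D_leibniz[of "\<lambda>_. r" "\<lambda>_. a" "\<lambda>_. u" x for r u] D_scale_left[of "\<lambda>_. r" "\<lambda>_. u" "\<lambda>_. b" x for r u]
  by (auto intro!: linearI simp: christoffel_def smooth_on_const assms deriv_along_def)

lemmas christoffel_simps = linear_add[OF christoffel_linear(1)] linear_add[OF christoffel_linear(2)]
  linear_diff[OF christoffel_linear(1)] linear_diff[OF christoffel_linear(2)]
  linear_scale[OF christoffel_linear(1)] linear_scale[OF christoffel_linear(2)]
  linear_0[OF christoffel_linear(1)] linear_0[OF christoffel_linear(2)]

lemma christoffel_smooth: "smooth_on (\<lambda>x. \<Gamma> x a b) U"
  unfolding christoffel_def by (intro D_smooth smooth_on_const)

lemma christoffel_sym: "x \<in> U \<Longrightarrow> \<Gamma> x a b = \<Gamma> x b a"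
  using D_torsion_free[of "\<lambda>_. a" "\<lambda>_. b" x]
  by (simp add: smooth_on_const christoffel_def lie_bracket_def)

text \<open>Expanding \<open>Y\<close>, then \<open>X\<close>, in the standard basis reduces the
  abstract operator to its values on constant fields, by additivity and the two rules for function
  factors. In particular the value at \<open>x\<close> depends on \<open>X\<close> through
  \<open>X x\<close> alone.\<close>

lemma D_eq:
  assumes "smooth_on X U" "smooth_on Y U" "x \<in> U"
  shows "D X Y x = dirderiv (X x) Y x + \<Gamma> x (X x) (Y x)"
proof -
  have s: "smooth_on (\<lambda>y. Y y \<bullet> j) U" "smooth_on (\<lambda>y. X y \<bullet> j) U" for j
    using assms by (simp_all add: smooth_on_inner_const open_U)
  have "cov i Y x = dirderiv i Y x + \<Gamma> x i (Y x)" for i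
  proof -
    have "cov i Y x = cov i (\<lambda>y. \<Sum>j\<in>Basis. (Y y \<bullet> j) *\<^sub>R j) x"
      by (simp add: euclidean_representation)
    also have "\<dots> = (\<Sum>j\<in>Basis. cov i (\<lambda>y. (Y y \<bullet> j) *\<^sub>R j) x)"
      by (intro D_sum_right smooth_on_scaleR smooth_on_const s open_U assms)
    also have "\<dots> = (\<Sum>j\<in>Basis. (Y x \<bullet> j) *\<^sub>R \<Gamma> x i j + (dirderiv i Y x \<bullet> j) *\<^sub>R j)"
      by (simp add: D_leibniz s smooth_on_const assms christoffel_def deriv_along_def
          dirderiv_bounded_linear[OF bounded_linear_inner_left assms(2,3)])
    also have "\<dots> = \<Gamma> x i (Y x) + dirderiv i Y x"
      by (simp add: sum.distrib euclidean_representation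
          linear_expand[OF christoffel_linear(1)[OF assms(3)], of i "Y x"])
    finally show ?thesis by simp
  qed
  note cov_i = this
  have "D X Y x = D (\<lambda>y. \<Sum>i\<in>Basis. (X y \<bullet> i) *\<^sub>R i) Y x"
    by (simp add: euclidean_representation)
  also have "\<dots> = (\<Sum>i\<in>Basis. D (\<lambda>y. (X y \<bullet> i) *\<^sub>R i) Y x)"
    by (intro D_sum_left smooth_on_scaleR smooth_on_const s open_U assms)
  also have "\<dots> = (\<Sum>i\<in>Basis. (X x \<bullet> i) *\<^sub>R dirderiv i Y x) + (\<Sum>i\<in>Basis. (X x \<bullet> i) *\<^sub>R \<Gamma> x i (Y x))"
    by (simp add: D_scale_left s smooth_on_const assms cov_i scaleR_add_right sum.distrib)
  also have "\<dots> = dirderiv (X x) Y x + \<Gamma> x (X x) (Y x)"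
    using linear_expand[OF linear_dirderiv[OF assms(2,3)], of "X x"]
      linear_expand[OF christoffel_linear(2)[OF assms(3)], of "X x" "Y x"] by simp
  finally show ?thesis .
qed

lemma cov_eq: "smooth_on Y U \<Longrightarrow> x \<in> U \<Longrightarrow> cov a Y x = dirderiv a Y x + \<Gamma> x a (Y x)"
  by (simp add: D_eq smooth_on_const)

lemma cov_smooth: "smooth_on Y U \<Longrightarrow> smooth_on (cov a Y) U"
  by (simp add: D_smooth smooth_on_const)

text \<open>The operator acts on functions defined on the whole space. That only their values on
  \<open>U\<close> matter at points of \<open>U\<close> is read off from
  \<open>cov_eq\<close>.\<close>

lemma cov_cong:
  assumes "\<And>y. y \<in> U \<Longrightarrow> Y y = Z y" "smooth_on Y U" "x \<in> U"
  shows "cov a Y x = cov a Z x"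
  using assms smooth_on_cong[OF open_U assms(1,2)] dirderiv_cong[OF open_U assms(3,1)]
  by (simp add: cov_eq)

lemma cov_diff:
  "smooth_on Y U \<Longrightarrow> smooth_on Z U \<Longrightarrow> x \<in> U \<Longrightarrow>
    cov a (\<lambda>y. Y y - Z y) x = cov a Y x - cov a Z x"
  by (simp add: cov_eq smooth_on_diff[OF open_U] dirderiv_diff christoffel_simps)

lemma cov_scaleR:
  "smooth_on h U \<Longrightarrow> smooth_on Y U \<Longrightarrow> x \<in> U \<Longrightarrow>
    cov a (\<lambda>y. h y *\<^sub>R Y y) x = h x *\<^sub>R cov a Y x + dirderiv a h x *\<^sub>R Y x"
  by (simp add: D_leibniz smooth_on_const deriv_along_def)

lemma dirderiv_G:
  "smooth_on Y U \<Longrightarrow> smooth_on Z U \<Longrightarrow> x \<in> U \<Longrightarrow>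
    dirderiv a (\<lambda>y. G y (Y y) (Z y)) x = G x (cov a Y x) (Z x) + G x (Y x) (cov a Z x)"
  using D_metric[of "\<lambda>_. a" Y Z x] by (simp add: smooth_on_const deriv_along_def)

section \<open>Symmetries of the curvature tensor\<close>

text \<open>Fields with constant components commute, so the bracket term is a derivative along the
  zero field and vanishes.\<close>

lemma curvature_eq_cov:
  assumes "x \<in> U"
  shows "K x a b w = cov a (\<lambda>y. \<Gamma> y b w) x - cov b (\<lambda>y. \<Gamma> y a w) x"
proof -
  have l: "lie_bracket (\<lambda>_. a) (\<lambda>_. b) = (\<lambda>_. 0)"
    by (simp add: fun_eq_iff lie_bracket_def)
  have "cov 0 (\<lambda>_. w) x = 0"
    using christoffel_simps(8)[OF assms] by (simp add: christoffel_def)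
  then show ?thesis unfolding curvature_def curvature_operator_def l
    by (simp add: christoffel_def[abs_def])
qed

lemma curvature_eq:
  assumes "x \<in> U"
  shows "K x a b w = dirderiv a (\<lambda>y. \<Gamma> y b w) x - dirderiv b (\<lambda>y. \<Gamma> y a w) x
    + \<Gamma> x a (\<Gamma> x b w) - \<Gamma> x b (\<Gamma> x a w)"
  using assms by (simp add: curvature_eq_cov cov_eq christoffel_smooth)

text \<open>The Ricci identity for a non-constant field. Second derivatives of \<open>W\<close>
  commute, and the terms with a first derivative of \<open>W\<close> are symmetric in
  \<open>a\<close> and \<open>b\<close>; only the value \<open>W x\<close> survives the
  antisymmetrization.\<close>

lemma curvature_field:
  assumes "smooth_on W U" "x \<in> U"
  shows "cov a (cov b W) x - cov b (cov a W) x = K x a b (W x)"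
proof -
  have *: "cov a (cov b W) x = dirderiv a (\<lambda>y. dirderiv b W y) x + dirderiv a (\<lambda>y. \<Gamma> y b (W x)) x
      + \<Gamma> x b (dirderiv a W x) + \<Gamma> x a (dirderiv b W x) + \<Gamma> x a (\<Gamma> x b (W x))" for a b
  proof -
    have s: "smooth_on (\<lambda>y. \<Gamma> y b (W y)) U" "smooth_on (\<lambda>y. dirderiv b W y) U"
      by (rule smooth_on_linear_apply[OF open_U christoffel_linear(1) christoffel_smooth assms(1)])
        (simp_all add: smooth_on_dirderiv[OF assms(1)])
    have "cov a (cov b W) x = cov a (\<lambda>y. dirderiv b W y + \<Gamma> y b (W y)) x"
      using assms by (intro cov_cong cov_smooth) (simp_all add: cov_eq)
    also have "\<dots> = dirderiv a (\<lambda>y. dirderiv b W y) x + dirderiv a (\<lambda>y. \<Gamma> y b (W y)) x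
        + \<Gamma> x a (dirderiv b W x + \<Gamma> x b (W x))"
      using s assms(2) by (simp add: cov_eq smooth_on_add[OF open_U] dirderiv_add)
    also have "dirderiv a (\<lambda>y. \<Gamma> y b (W y)) x
        = dirderiv a (\<lambda>y. \<Gamma> y b (W x)) x + \<Gamma> x b (dirderiv a W x)"
      by (rule dirderiv_linear_apply[OF open_U christoffel_linear(1) christoffel_smooth assms])
    finally show ?thesis using assms(2) by (simp add: christoffel_simps)
  qed
  show ?thesis
    unfolding * curvature_eq[OF assms(2)] using dirderiv_commute[OF open_U assms, of a b] by simp
qed

lemma curvature_smooth: "smooth_on (\<lambda>x. K x a b w) U"
proof (rule smooth_on_cong[OF open_U curvature_eq_cov[symmetric]])
  show "smooth_on (\<lambda>x. cov a (\<lambda>y. \<Gamma> y b w) x - cov b (\<lambda>y. \<Gamma> y a w) x) U"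
    by (intro smooth_on_diff open_U cov_smooth christoffel_smooth)
qed

lemma curvature_antisym: "x \<in> U \<Longrightarrow> K x a b w = - K x b a w"
  by (simp add: curvature_eq)

lemma dirderiv_christoffel_linear:
  assumes "x \<in> U"
  shows "linear (\<lambda>w. dirderiv a (\<lambda>y. \<Gamma> y b w) x)" "linear (\<lambda>b. dirderiv a (\<lambda>y. \<Gamma> y b w) x)"
proof -
  have "dirderiv a (\<lambda>y. \<Gamma> y b (w + w')) x = dirderiv a (\<lambda>y. \<Gamma> y b w + \<Gamma> y b w') x"
    "dirderiv a (\<lambda>y. \<Gamma> y (b + b') w) x = dirderiv a (\<lambda>y. \<Gamma> y b w + \<Gamma> y b' w) x"
    "dirderiv a (\<lambda>y. \<Gamma> y b (r *\<^sub>R w)) x = dirderiv a (\<lambda>y. r *\<^sub>R \<Gamma> y b w) x"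
    "dirderiv a (\<lambda>y. \<Gamma> y (r *\<^sub>R b) w) x = dirderiv a (\<lambda>y. r *\<^sub>R \<Gamma> y b w) x" for b b' w w' r
    by (rule fun_cong[OF dirderiv_cong[OF open_U assms]], simp add: christoffel_simps)+
  then show "linear (\<lambda>w. dirderiv a (\<lambda>y. \<Gamma> y b w) x)" "linear (\<lambda>b. dirderiv a (\<lambda>y. \<Gamma> y b w) x)"
    using assms dirderiv_bounded_linear[OF bounded_linear_scaleR_right christoffel_smooth assms]
    by (auto intro!: linearI simp: dirderiv_add[OF christoffel_smooth christoffel_smooth])
qed

lemma curvature_linear:
  assumes "x \<in> U"
  shows "linear (K x a b)" "linear (\<lambda>b. K x a b w)" "linear (\<lambda>a. K x a b w)"
proof -
  have c: "linear (\<lambda>w. \<Gamma> x a (\<Gamma> x b w))" "linear (\<lambda>w. \<Gamma> x w (\<Gamma> x a b))" "linear (\<lambda>w. \<Gamma> x a (\<Gamma> x w b))"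
    for a b using assms by (auto intro!: linearI simp: christoffel_simps)
  note dl = linear_dirderiv[OF christoffel_smooth assms]
  show "linear (K x a b)" "linear (\<lambda>b. K x a b w)" for a
    unfolding curvature_eq[OF assms, abs_def]
    by (intro linear_compose_sub linear_compose_add c dl dirderiv_christoffel_linear[OF assms])+
  then have "linear (\<lambda>a. - K x b a w)" by (simp add: linear_compose_neg)
  then show "linear (\<lambda>a. K x a b w)" using curvature_antisym[OF assms, of _ b w] by simp
qed

lemmas curvature_simps =
  linear_add[OF curvature_linear(1)] linear_add[OF curvature_linear(2)] linear_add[OF curvature_linear(3)]
  linear_diff[OF curvature_linear(1)] linear_diff[OF curvature_linear(2)] linear_diff[OF curvature_linear(3)]
  linear_scale[OF curvature_linear(1)] linear_scale[OF curvature_linear(2)] linear_scale[OF curvature_linear(3)]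

text \<open>Written with \<open>curvature_eq_cov\<close>, the cyclic sum has six terms, which cancel
  in pairs by the symmetry of the Christoffel symbols.\<close>

lemma first_Bianchi:
  assumes "x \<in> U" shows "K x a b c + K x b c a + K x c a b = 0"
proof -
  have "cov a (\<lambda>y. \<Gamma> y b c) x = cov a (\<lambda>y. \<Gamma> y c b) x" for a b c
    using assms by (intro cov_cong christoffel_sym christoffel_smooth)
  then show ?thesis using assms by (simp add: curvature_eq_cov)
qed

text \<open>Differentiate the function \<open>G y w v\<close> twice using metric compatibility. The
  second derivatives commute and the mixed products of Christoffel terms are symmetric in
  \<open>a\<close> and \<open>b\<close>, which leaves the two curvature terms.\<close>

lemma curvature_skew:
  assumes "x \<in> U" shows "G x (K x a b w) v = - G x w (K x a b v)"
proof -
  let ?h = "\<lambda>y. G y w v"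
  have s: "smooth_on (\<lambda>y. G y (\<Gamma> y b w) v) U" "smooth_on (\<lambda>y. G y w (\<Gamma> y b v)) U" for b w v
    by (intro smooth_G smooth_on_const christoffel_smooth)+
  have cc: "cov a (\<lambda>_. w) x = \<Gamma> x a w" for a w x by (simp add: christoffel_def)
  have "dirderiv a (\<lambda>y. dirderiv b ?h y) x
      = G x (cov a (\<lambda>y. \<Gamma> y b w) x) v + G x (\<Gamma> x b w) (\<Gamma> x a v)
        + G x (\<Gamma> x a w) (\<Gamma> x b v) + G x w (cov a (\<lambda>y. \<Gamma> y b v) x)" for a b
  proof -
    have "dirderiv a (\<lambda>y. dirderiv b ?h y) x
        = dirderiv a (\<lambda>y. G y (\<Gamma> y b w) v + G y w (\<Gamma> y b v)) x"
      by (rule fun_cong[OF dirderiv_cong[OF open_U assms]])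
        (simp add: dirderiv_G smooth_on_const cc)
    then show ?thesis
      using assms by (simp add: dirderiv_add[OF s] dirderiv_G smooth_on_const christoffel_smooth cc)
  qed
  then show ?thesis
    using dirderiv_commute_real[OF open_U G_smooth[of w v] assms, of a b] G_sym[OF assms] assms
    by (simp add: curvature_eq_cov G_simps)
qed

text \<open>The value of \<open>(nabla_c R)(a, b) w\<close>. The constant extensions of the
  arguments are not parallel, and the last three terms correct for their covariant
  derivatives.\<close>

definition cov_curvature :: "'v \<Rightarrow> 'v \<Rightarrow> 'v \<Rightarrow> 'v \<Rightarrow> 'v \<Rightarrow> 'v" where
  "cov_curvature x c a b w = cov c (\<lambda>y. K y a b w) x
     - K x (\<Gamma> x c a) b w - K x a (\<Gamma> x c b) w - K x a b (\<Gamma> x c w)"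

text \<open>
  On fields with constant components this is the Jacobi identity for the operators \<open>cov a\<close>; the
  Christoffel terms cancel because the connection is torsion free.
\<close>

lemma second_Bianchi:
  assumes "x \<in> U"
  shows "cov_curvature x a b c w + cov_curvature x b c a w + cov_curvature x c a b w = 0"
proof -
  have *: "cov c (\<lambda>y. K y a b w) x - K x a b (\<Gamma> x c w)
      = cov c (cov a (cov b (\<lambda>_. w))) x - cov c (cov b (cov a (\<lambda>_. w))) x
        - (cov a (cov b (cov c (\<lambda>_. w))) x - cov b (cov a (cov c (\<lambda>_. w))) x)" for a b c
  proof -
    have s: "smooth_on (cov a (cov b (\<lambda>_. w))) U" for a b
      by (intro cov_smooth smooth_on_const)
    have "cov c (\<lambda>y. K y a b w) x = cov c (\<lambda>y. cov a (cov b (\<lambda>_. w)) y - cov b (cov a (\<lambda>_. w)) y) x"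
      using assms curvature_field[OF smooth_on_const]
      by (intro cov_cong curvature_smooth) simp_all
    moreover have "K x a b (\<Gamma> x c w)
        = cov a (cov b (cov c (\<lambda>_. w))) x - cov b (cov a (cov c (\<lambda>_. w))) x"
      using curvature_field[OF cov_smooth[OF smooth_on_const] assms, of a b c w]
      by (simp add: christoffel_def)
    ultimately show ?thesis by (simp add: cov_diff[OF s s assms])
  qed
  have "cov_curvature x c a b w = (cov c (\<lambda>y. K y a b w) x - K x a b (\<Gamma> x c w))
     - K x (\<Gamma> x c a) b w - K x a (\<Gamma> x c b) w" for a b c
    by (simp add: cov_curvature_def)
  then show ?thesis
    using curvature_antisym[OF assms, of "\<Gamma> x a b" c w] curvature_antisym[OF assms, of "\<Gamma> x b c" a w]
      curvature_antisym[OF assms, of "\<Gamma> x c a" b w] christoffel_sym[OF assms]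
    by (simp add: *)
qed

end

section \<open>Traces of endomorphisms in the standard basis\<close>

text \<open>Commutators have trace zero: both sides are the same double sum of matrix entries with
  the order of summation exchanged.\<close>

lemma trace_commute:
  fixes P R :: "'v::euclidean_space \<Rightarrow> 'v"
  assumes "linear P" "linear R"
  shows "(\<Sum>b\<in>Basis. P (R b) \<bullet> b) = (\<Sum>b\<in>Basis. R (P b) \<bullet> b)"
proof -
  have *: "(\<Sum>b\<in>Basis. P (R b) \<bullet> b) = (\<Sum>b\<in>Basis. \<Sum>c\<in>Basis. (R b \<bullet> c) * (P c \<bullet> b))"
    if "linear P" for P R :: "'v \<Rightarrow> 'v"
    by (subst linear_expand[OF that]) (simp add: inner_sum_left)
  show ?thesis
    unfolding *[OF assms(1), of R] *[OF assms(2), of P]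
    by (subst sum.swap) (simp add: mult.commute)
qed

text \<open>The left-hand side is the trace of the endomorphism sending \<open>b\<close> to
  \<open>L b *\<^sub>R v\<close>.\<close>

lemma trace_rank_one:
  fixes L :: "'v::euclidean_space \<Rightarrow> real"
  assumes "linear L"
  shows "(\<Sum>b\<in>Basis. L b * (v \<bullet> b)) = L v"
  by (subst (2) linear_expand[OF assms]) (simp add: mult.commute)

text \<open>Contract the derivation formula over its slot \<open>w1\<close>. The first two terms are
  the products, in both orders, of \<open>K x u v\<close> with the endomorphism being traced, so
  their traces cancel; the other two contract to the Ricci tensor.\<close>

lemma (in coordinate_metric) ricci_semisymmetric_of_semisymmetric:
  assumes "x \<in> U"
    and "\<And>w1 w2 w3. K x u v (K x w1 w2 w3) - K x (K x u v w1) w2 w3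
      - K x w1 (K x u v w2) w3 - K x w1 w2 (K x u v w3) = 0"
  shows "ricci D x (K x u v w1) w2 + ricci D x w1 (K x u v w2) = 0"
proof -
  have "(\<Sum>b\<in>Basis. (K x u v (K x b w1 w2) - K x (K x u v b) w1 w2
      - K x b (K x u v w1) w2 - K x b w1 (K x u v w2)) \<bullet> b) = 0"
    by (simp only: assms(2)) simp
  moreover have "(\<Sum>b\<in>Basis. K x u v (K x b w1 w2) \<bullet> b) = (\<Sum>b\<in>Basis. K x (K x u v b) w1 w2 \<bullet> b)"
    by (rule trace_commute[OF curvature_linear(1)[OF assms(1)] curvature_linear(3)[OF assms(1)]])
  ultimately show ?thesis
    by (simp add: ricci_def inner_diff_left sum_subtractf)
qed

section \<open>Curvature of a Kenmotsu manifold in a chart\<close>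

text \<open>The structure is recast without \<phi>: its effect is the formula \<open>cov_xi\<close>
  for the derivative of \<xi>, the form \<eta> is written as the metric dual of \<xi>, and
  \<open>dirderiv_F\<close> expresses that df is a multiple of \<eta>.\<close>

locale kenmotsu_chart = coordinate_metric U G D
  for U :: "'v::euclidean_space set" and G D +
  fixes \<xi> :: "'v \<Rightarrow> 'v" and F :: "'v \<Rightarrow> real"
  assumes xi_smooth: "smooth_on \<xi> U"
    and F_smooth: "smooth_on F U"
    and G_xi_xi: "\<And>x. x \<in> U \<Longrightarrow> G x (\<xi> x) (\<xi> x) = 1"
    and cov_xi: "\<And>x a. x \<in> U \<Longrightarrow> D (\<lambda>_. a) \<xi> x = F x *\<^sub>R (a - G x a (\<xi> x) *\<^sub>R \<xi> x)"
    and dirderiv_F: "\<And>x a. x \<in> U \<Longrightarrow> dirderiv a F x = dirderiv (\<xi> x) F x * G x a (\<xi> x)"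
begin

text \<open>By \<open>curvature_xi\<close>, minus this function is the sectional curvature of every
  plane containing \<xi>. Regularity says that it has no zero.\<close>

definition lam :: "'v \<Rightarrow> real" ("\<lambda>\<^sub>F") where
  "\<lambda>\<^sub>F x = (F x)\<^sup>2 + dirderiv (\<xi> x) F x"

lemma lam_smooth: "smooth_on \<lambda>\<^sub>F U"
proof -
  have "smooth_on (\<lambda>x. dirderiv (\<xi> x) F x) U"
    by (rule smooth_on_linear_apply[where B="\<lambda>x h. dirderiv h F x", OF open_U
          linear_dirderiv[OF F_smooth] smooth_on_dirderiv[OF F_smooth] xi_smooth])
  then show ?thesis
    unfolding lam_def[abs_def] power2_eq_square
    by (intro smooth_on_add smooth_on_mult open_U F_smooth)
qed

text \<open>Differentiate \<open>cov_xi\<close> again and antisymmetrize. The Christoffel terms and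
  the derivative of \<eta> are symmetric in \<open>a\<close> and \<open>b\<close> and drop out; the
  square of \<open>F\<close> comes from differentiating the factor \<xi>, and the derivative of
  \<open>F\<close> along \<xi> from differentiating \<open>F\<close>.\<close>

lemma curvature_xi:
  assumes "x \<in> U"
  shows "K x a b (\<xi> x) = \<lambda>\<^sub>F x *\<^sub>R (G x a (\<xi> x) *\<^sub>R b - G x b (\<xi> x) *\<^sub>R a)"
proof -
  let ?\<eta> = "\<lambda>b y. G y b (\<xi> y)"
  have s: "smooth_on (?\<eta> b) U" for b by (intro smooth_G smooth_on_const xi_smooth)
  have s2: "smooth_on (\<lambda>y. ?\<eta> b y *\<^sub>R \<xi> y) U" for b by (intro smooth_on_scaleR s open_U xi_smooth)
  have s3: "smooth_on (\<lambda>y. b - ?\<eta> b y *\<^sub>R \<xi> y) U" for b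
    by (intro smooth_on_diff s2 open_U smooth_on_const)
  have "cov a (cov b \<xi>) x = F x *\<^sub>R (\<Gamma> x a b - (?\<eta> b x *\<^sub>R (F x *\<^sub>R (a - ?\<eta> a x *\<^sub>R \<xi> x))
      + (G x (\<Gamma> x a b) (\<xi> x) + F x * (G x a b - ?\<eta> a x * ?\<eta> b x)) *\<^sub>R \<xi> x))
      + (dirderiv (\<xi> x) F x * ?\<eta> a x) *\<^sub>R (b - ?\<eta> b x *\<^sub>R \<xi> x)" for a b
  proof -
    have "dirderiv a (?\<eta> b) x = G x (\<Gamma> x a b) (\<xi> x) + G x b (cov a \<xi> x)"
      using assms by (simp add: dirderiv_G smooth_on_const xi_smooth christoffel_def)
    also have "G x b (cov a \<xi> x) = F x * (G x a b - ?\<eta> a x * ?\<eta> b x)"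
      using assms by (simp add: cov_xi G_simps G_sym[of x a b])
    finally have d\<eta>: "dirderiv a (?\<eta> b) x = \<dots> + G x (\<Gamma> x a b) (\<xi> x)" by simp
    have "cov a (cov b \<xi>) x = cov a (\<lambda>y. F y *\<^sub>R (b - ?\<eta> b y *\<^sub>R \<xi> y)) x"
      using assms by (intro cov_cong cov_xi cov_smooth xi_smooth)
    also have "\<dots> = F x *\<^sub>R cov a (\<lambda>y. b - ?\<eta> b y *\<^sub>R \<xi> y) x + dirderiv a F x *\<^sub>R (b - ?\<eta> b x *\<^sub>R \<xi> x)"
      by (rule cov_scaleR[OF F_smooth s3 assms])
    also have "cov a (\<lambda>y. b - ?\<eta> b y *\<^sub>R \<xi> y) x = \<Gamma> x a b - cov a (\<lambda>y. ?\<eta> b y *\<^sub>R \<xi> y) x"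
      by (simp add: cov_diff[OF smooth_on_const s2 assms] christoffel_def)
    also have "cov a (\<lambda>y. ?\<eta> b y *\<^sub>R \<xi> y) x = ?\<eta> b x *\<^sub>R cov a \<xi> x + dirderiv a (?\<eta> b) x *\<^sub>R \<xi> x"
      by (rule cov_scaleR[OF s xi_smooth assms])
    finally show ?thesis
      unfolding d\<eta> cov_xi[OF assms] dirderiv_F[OF assms, of a] by (simp add: add.commute)
  qed
  note cc = this
  show ?thesis
    unfolding curvature_field[OF xi_smooth assms, symmetric] cc
      christoffel_sym[OF assms, of b a] G_sym[OF assms, of b a]
    by (simp add: lam_def algebra_simps power2_eq_square)
qed

section \<open>The deviation from constant sectional curvature\<close>

definition Q :: "'v \<Rightarrow> 'v \<Rightarrow> 'v \<Rightarrow> 'v \<Rightarrow> 'v" where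
  "Q x a b w = K x a b w + \<lambda>\<^sub>F x *\<^sub>R (G x b w *\<^sub>R a - G x a w *\<^sub>R b)"

lemma Q_linear:
  assumes "x \<in> U"
  shows "linear (Q x a b)" "linear (\<lambda>b. Q x a b w)" "linear (\<lambda>a. Q x a b w)"
  using assms
  by (auto intro!: linearI simp: Q_def curvature_simps G_simps algebra_simps)

lemmas Q_simps =
  linear_diff[OF Q_linear(1)] linear_diff[OF Q_linear(2)] linear_diff[OF Q_linear(3)]
  linear_scale[OF Q_linear(1)] linear_scale[OF Q_linear(2)] linear_scale[OF Q_linear(3)]
  linear_0[OF Q_linear(1)] linear_0[OF Q_linear(2)] linear_0[OF Q_linear(3)]

lemma smooth_space_form: "smooth_on (\<lambda>x. G x b w *\<^sub>R a - G x a w *\<^sub>R b) U"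
  by (intro smooth_on_diff smooth_on_scaleR open_U G_smooth smooth_on_const)

lemma Q_smooth: "smooth_on (\<lambda>x. Q x a b w) U"
  unfolding Q_def
  by (intro smooth_on_add smooth_on_scaleR[OF _ lam_smooth] open_U curvature_smooth smooth_space_form)

lemma Q_antisym: "x \<in> U \<Longrightarrow> Q x a b w = - Q x b a w"
  using curvature_antisym[of x a b w] by (simp add: Q_def algebra_simps)

lemma Q_xi_right: "x \<in> U \<Longrightarrow> Q x a b (\<xi> x) = 0"
  by (simp add: Q_def curvature_xi algebra_simps)

lemma Q_skew: "x \<in> U \<Longrightarrow> G x (Q x a b w) v = - G x w (Q x a b v)"
  by (simp add: Q_def G_simps curvature_skew[of x a b w v] G_sym[of x w a] G_sym[of x w b] algebra_simps)

lemma Q_Bianchi: "x \<in> U \<Longrightarrow> Q x a b c + Q x b c a + Q x c a b = 0"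
  using first_Bianchi[of x a b c]
  by (simp add: Q_def G_sym[of x b a] G_sym[of x c a] G_sym[of x c b] algebra_simps)

text \<open>
  By the first Bianchi identity \<open>G (Q y \<xi> w) v\<close> is symmetric in \<open>y, w\<close>, and it is skew in
  \<open>w, v\<close>; such a trilinear form vanishes.
\<close>

lemma Q_xi_middle:
  assumes "x \<in> U" shows "Q x y (\<xi> x) w = 0"
proof (rule G_nondegenerate[OF assms])
  fix v
  let ?B = "\<lambda>y w v. G x (Q x y (\<xi> x) w) v"
  have sym: "?B y w v = ?B w y v" for y w v
    using Q_Bianchi[OF assms, of y "\<xi> x" w] Q_xi_right[OF assms, of w y] Q_antisym[OF assms, of "\<xi> x" w y]
    by simp
  have skew: "?B y w v = - ?B y v w" for y w v
    using Q_skew[OF assms, of y "\<xi> x" w v] G_sym[OF assms] by simp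
  show "?B y w v = 0"
    using sym[of y w v] skew[of w y v] sym[of w v y] skew[of v w y] sym[of v y w] skew[of y v w]
    by linarith
qed

text \<open>Hence \<open>Q\<close> is trace free exactly when the Ricci tensor is the expected
  multiple of the metric. For \<open>w\<close> equal to \<xi> the left-hand side vanishes anyway,
  which determines the Ricci tensor on \<xi>.\<close>

lemma trace_Q:
  assumes "x \<in> U"
  shows "(\<Sum>b\<in>Basis. Q x b v w \<bullet> b) = ricci D x v w + (DIM('v) - 1) * \<lambda>\<^sub>F x * G x v w"
proof -
  have "(\<Sum>b\<in>Basis. Q x b v w \<bullet> b)
      = ricci D x v w + \<lambda>\<^sub>F x * (DIM('v) * G x v w - (\<Sum>b\<in>Basis. G x b w * (v \<bullet> b)))"
    by (simp add: Q_def ricci_def inner_add_left inner_diff_left sum.distrib sum_subtractf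
        right_diff_distrib sum_distrib_left)
  also have "(\<Sum>b\<in>Basis. G x b w * (v \<bullet> b)) = G x v w"
    by (rule trace_rank_one[OF G_linear(2)[OF assms]])
  finally show ?thesis by (simp add: algebra_simps)
qed

lemma ricci_xi:
  assumes "x \<in> U" shows "ricci D x v (\<xi> x) = - ((DIM('v) - 1) * \<lambda>\<^sub>F x * G x v (\<xi> x))"
  using trace_Q[OF assms, of v "\<xi> x"] Q_xi_right[OF assms] by simp

lemma ricci_linear: "x \<in> U \<Longrightarrow> linear (ricci D x v)"
  by (auto intro!: linearI simp: ricci_def curvature_simps inner_add_left sum.distrib sum_distrib_left)

lemma ricci_of_semisymmetric:
  assumes "x \<in> U" "\<lambda>\<^sub>F x \<noteq> 0"
    and "\<And>u v w1 w2. ricci D x (K x u v w1) w2 + ricci D x w1 (K x u v w2) = 0"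
  shows "ricci D x v w = - ((DIM('v) - 1) * \<lambda>\<^sub>F x * G x v w)"
proof -
  define m where "m = real DIM('v) - 1"
  let ?\<xi> = "\<xi> x"
  have S\<xi>: "ricci D x v ?\<xi> = - (m * \<lambda>\<^sub>F x * G x v ?\<xi>)" for v
    using ricci_xi[OF assms(1)] by (simp add: m_def)
  note lin = linear_diff[OF ricci_linear[OF assms(1)]] linear_scale[OF ricci_linear[OF assms(1)]]
  have K: "K x ?\<xi> w ?\<xi> = \<lambda>\<^sub>F x *\<^sub>R (w - G x w ?\<xi> *\<^sub>R ?\<xi>)"
    using curvature_xi[OF assms(1)] G_xi_xi[OF assms(1)] by simp
  \<comment> \<open>The vector \<open>K x ?\<xi> w v\<close> itself is not known, but by
    \<open>S\<xi>\<close> its Ricci pairing with \<xi> needs only this component, which skew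
    symmetry reduces to the curvature on \<xi>.\<close>
  have "G x (K x ?\<xi> w v) ?\<xi> = - \<lambda>\<^sub>F x * (G x v w - G x v ?\<xi> * G x w ?\<xi>)"
    using curvature_skew[OF assms(1), of ?\<xi> w v ?\<xi>] assms(1) by (simp add: K G_simps)
  then have "ricci D x (K x ?\<xi> w v) ?\<xi> = m * (\<lambda>\<^sub>F x)\<^sup>2 * (G x v w - G x v ?\<xi> * G x w ?\<xi>)"
    by (simp add: S\<xi> power2_eq_square)
  moreover have "ricci D x v (K x ?\<xi> w ?\<xi>)
      = \<lambda>\<^sub>F x * (ricci D x v w + G x w ?\<xi> * (m * \<lambda>\<^sub>F x * G x v ?\<xi>))"
    by (simp add: K lin S\<xi>)
  ultimately have "\<lambda>\<^sub>F x * (ricci D x v w + m * \<lambda>\<^sub>F x * G x v w) = 0"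
    using assms(3)[of ?\<xi> w v ?\<xi>] by (simp add: algebra_simps power2_eq_square)
  then show ?thesis using assms(2) by (simp add: m_def eq_neg_iff_add_eq_0)
qed

section \<open>A Schur lemma along the structure vector field\<close>

text \<open>The value of \<open>(nabla_c Q)(a, b) w\<close>, encoded in the same way as
  \<open>cov_curvature\<close>.\<close>

definition cov_Q :: "'v \<Rightarrow> 'v \<Rightarrow> 'v \<Rightarrow> 'v \<Rightarrow> 'v \<Rightarrow> 'v" where
  "cov_Q x c a b w = cov c (\<lambda>y. Q y a b w) x
     - Q x (\<Gamma> x c a) b w - Q x a (\<Gamma> x c b) w - Q x a b (\<Gamma> x c w)"

lemma cov_add:
  "smooth_on Y U \<Longrightarrow> smooth_on Z U \<Longrightarrow> x \<in> U \<Longrightarrow>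
    cov a (\<lambda>y. Y y + Z y) x = cov a Y x + cov a Z x"
  by (simp add: D_add_right smooth_on_const)

text \<open>The metric is parallel, so in the constant curvature part of \<open>Q\<close> only the
  factor \<lambda> gets differentiated; the other terms cancel against the Christoffel
  corrections.\<close>

lemma cov_Q_eq:
  assumes "x \<in> U"
  shows "cov_Q x c a b w = cov_curvature x c a b w
    + dirderiv c \<lambda>\<^sub>F x *\<^sub>R (G x b w *\<^sub>R a - G x a w *\<^sub>R b)"
proof -
  have s: "smooth_on (\<lambda>y. G y u w *\<^sub>R v) U" for u v w
    by (intro smooth_on_scaleR open_U G_smooth smooth_on_const)
  have c: "cov c (\<lambda>y. G y u w *\<^sub>R v) x
      = G x u w *\<^sub>R \<Gamma> x c v + (G x (\<Gamma> x c u) w + G x u (\<Gamma> x c w)) *\<^sub>R v" for u v w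
    using assms cov_scaleR[OF G_smooth smooth_on_const]
      dirderiv_G[OF smooth_on_const[of u] smooth_on_const[of w] assms, of c]
    by (simp add: christoffel_def)
  have "cov c (\<lambda>y. Q y a b w) x = cov c (\<lambda>y. K y a b w) x
      + cov c (\<lambda>y. \<lambda>\<^sub>F y *\<^sub>R (G y b w *\<^sub>R a - G y a w *\<^sub>R b)) x"
    unfolding Q_def
    by (intro cov_add curvature_smooth smooth_on_scaleR open_U lam_smooth smooth_space_form assms)
  also have "cov c (\<lambda>y. \<lambda>\<^sub>F y *\<^sub>R (G y b w *\<^sub>R a - G y a w *\<^sub>R b)) x
      = \<lambda>\<^sub>F x *\<^sub>R cov c (\<lambda>y. G y b w *\<^sub>R a - G y a w *\<^sub>R b) x
        + dirderiv c \<lambda>\<^sub>F x *\<^sub>R (G x b w *\<^sub>R a - G x a w *\<^sub>R b)"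
    by (rule cov_scaleR[OF lam_smooth smooth_space_form assms])
  also have "cov c (\<lambda>y. G y b w *\<^sub>R a - G y a w *\<^sub>R b) x
      = cov c (\<lambda>y. G y b w *\<^sub>R a) x - cov c (\<lambda>y. G y a w *\<^sub>R b) x"
    by (rule cov_diff[OF s s assms])
  finally show ?thesis
    unfolding c cov_Q_def cov_curvature_def by (simp add: Q_def algebra_simps)
qed

lemma cov_Q_antisym:
  assumes "x \<in> U" shows "cov_Q x c a b w = - cov_Q x c b a w"
proof -
  have s: "smooth_on (\<lambda>_. 0 :: 'v) U" by (rule smooth_on_const)
  have "cov c (\<lambda>y. Q y a b w) x = cov c (\<lambda>y. 0 - Q y b a w) x"
  proof (rule cov_cong[OF _ Q_smooth assms])
    show "Q y a b w = 0 - Q y b a w" if "y \<in> U" for y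
      unfolding diff_0 by (rule Q_antisym[OF that])
  qed
  also have "\<dots> = cov c (\<lambda>_. 0) x - cov c (\<lambda>y. Q y b a w) x"
    by (rule cov_diff[OF s Q_smooth assms])
  also have "cov c (\<lambda>_. 0) x = 0"
    using christoffel_simps(7)[OF assms, of c] unfolding christoffel_def .
  finally have c: "cov c (\<lambda>y. Q y a b w) x = - cov c (\<lambda>y. Q y b a w) x" by simp
  show ?thesis
    unfolding cov_Q_def c Q_antisym[OF assms, of "\<Gamma> x c a" b w]
      Q_antisym[OF assms, of a "\<Gamma> x c b" w] Q_antisym[OF assms, of a b "\<Gamma> x c w"] by simp
qed

text \<open>Covariant differentiation commutes with contraction. The trace is differentiated, hence
  it must vanish on all of \<open>U\<close> and not only at \<open>x\<close>.\<close>

lemma trace_cov_Q: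
  assumes "x \<in> U" and trace: "\<And>x v w. x \<in> U \<Longrightarrow> (\<Sum>b\<in>Basis. Q x b v w \<bullet> b) = 0"
  shows "(\<Sum>b\<in>Basis. cov_Q x c b v w \<bullet> b) = 0"
proof -
  have "(\<Sum>b\<in>Basis. dirderiv c (\<lambda>y. Q y b v w) x \<bullet> b)
      = dirderiv c (\<lambda>y. \<Sum>b\<in>Basis. Q y b v w \<bullet> b) x"
    by (simp add: dirderiv_sum[where S=U and F="\<lambda>b y. Q y b v w \<bullet> b",
          OF smooth_on_inner_const[OF open_U Q_smooth] assms(1)]
        dirderiv_bounded_linear[OF bounded_linear_inner_left Q_smooth assms(1)])
  also have "\<dots> = dirderiv c (\<lambda>y. 0) x"
    by (rule fun_cong[OF dirderiv_cong[OF open_U assms(1)]], rule trace)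
  finally have "(\<Sum>b\<in>Basis. dirderiv c (\<lambda>y. Q y b v w) x \<bullet> b) = 0" by simp
  \<comment> \<open>The Christoffel terms of the value and of the contracted slot form the trace of
    a commutator.\<close>
  moreover have "(\<Sum>b\<in>Basis. \<Gamma> x c (Q x b v w) \<bullet> b) = (\<Sum>b\<in>Basis. Q x (\<Gamma> x c b) v w \<bullet> b)"
    by (rule trace_commute[OF christoffel_linear(1)[OF assms(1)] Q_linear(3)[OF assms(1)]])
  ultimately show ?thesis
    using trace[OF assms(1)]
    by (simp add: cov_Q_def cov_eq[OF Q_smooth assms(1)] inner_add_left inner_diff_left
        sum.distrib sum_subtractf)
qed

text \<open>Differentiate the identity \<open>Q z y (\<xi> z) w = 0\<close>. The derivative moves
  onto \<xi>, where \<open>cov_xi\<close> gives a multiple of \<open>b\<close> up to a component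
  along \<xi>, which \<open>Q\<close> annihilates.\<close>

lemma cov_Q_xi:
  assumes "x \<in> U" shows "cov_Q x b y (\<xi> x) w = F x *\<^sub>R Q x b y w"
proof -
  \<comment> \<open>Here \<xi> is frozen at \<open>x\<close>, because \<open>cov_Q\<close>
    differentiates with constant arguments.\<close>
  let ?c = "dirderiv b (\<lambda>z. Q z y (\<xi> x) w) x"
  have "dirderiv b (\<lambda>z. Q z y (\<xi> z) w) x = dirderiv b (\<lambda>_. 0) x"
    by (rule fun_cong[OF dirderiv_cong[OF open_U assms]], rule Q_xi_middle)
  moreover have "dirderiv b (\<lambda>z. Q z y (\<xi> z) w) x = ?c + Q x y (dirderiv b \<xi> x) w"
    by (rule dirderiv_linear_apply[where B="\<lambda>z v. Q z y v w"])
      (rule open_U Q_linear(2) Q_smooth xi_smooth assms, assumption?)+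
  ultimately have c: "?c = - Q x y (dirderiv b \<xi> x) w"
    by (simp only: frechet_derivative_const) (metis eq_neg_iff_add_eq_0)
  have "cov_Q x b y (\<xi> x) w = ?c - Q x y (\<Gamma> x b (\<xi> x)) w"
    unfolding cov_Q_def cov_eq[OF Q_smooth assms] Q_xi_middle[OF assms] christoffel_simps(7)[OF assms]
    by simp
  also have "\<dots> = - Q x y (cov b \<xi> x) w"
    unfolding c cov_eq[OF xi_smooth assms] linear_add[OF Q_linear(2)[OF assms]] by simp
  also have "\<dots> = - F x *\<^sub>R Q x y b w"
    unfolding cov_xi[OF assms] Q_simps[OF assms] Q_xi_middle[OF assms] by simp
  also have "\<dots> = F x *\<^sub>R Q x b y w"
    unfolding Q_antisym[OF assms, of b y w] by simp
  finally show ?thesis .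
qed

text \<open>As in Schur's lemma, the contracted second Bianchi identity controls the gradient. Since
  one argument is \<xi>, the only undifferentiated curvature term left is a multiple of
  \<open>Q\<close>, and its trace vanishes as well.\<close>

lemma dirderiv_lam_zero:
  assumes dim: "DIM('v) \<ge> 3" and "x \<in> U"
    and trace: "\<And>x v w. x \<in> U \<Longrightarrow> (\<Sum>b\<in>Basis. Q x b v w \<bullet> b) = 0"
  shows "dirderiv v \<lambda>\<^sub>F x = 0"
proof -
  let ?\<xi> = "\<xi> x" and ?d = "\<lambda>h. dirderiv h \<lambda>\<^sub>F x"
  note lin = linear_dirderiv[OF lam_smooth assms(2)]
  have key: "?d y * G x ?\<xi> w = ?d ?\<xi> * G x y w" for y w
  proof -
    \<comment> \<open>This is the second Bianchi identity for \<open>b\<close>, \<open>y\<close> and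
      \<xi>. Antisymmetry has moved \<open>b\<close> into the first tensor slot of the middle term,
      so that summing over \<open>b\<close> is a trace to which \<open>trace_cov_Q\<close>
      applies.\<close>
    have E: "F x *\<^sub>R Q x b y w - cov_Q x y b ?\<xi> w + cov_Q x ?\<xi> b y w
        = ?d b *\<^sub>R (G x ?\<xi> w *\<^sub>R y - G x y w *\<^sub>R ?\<xi>) + ?d y *\<^sub>R (G x b w *\<^sub>R ?\<xi> - G x ?\<xi> w *\<^sub>R b)
          + ?d ?\<xi> *\<^sub>R (G x y w *\<^sub>R b - G x b w *\<^sub>R y)" (is "?A = ?T") for b
    proof -
      have "?A = cov_Q x b y ?\<xi> w + cov_Q x y ?\<xi> b w + cov_Q x ?\<xi> b y w"
        by (simp only: cov_Q_xi[OF assms(2), of b y w] cov_Q_antisym[OF assms(2), of y ?\<xi> b w]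
            diff_conv_add_uminus)
      also have "\<dots> = cov_curvature x b y ?\<xi> w + cov_curvature x y ?\<xi> b w + cov_curvature x ?\<xi> b y w + ?T"
        by (simp only: cov_Q_eq[OF assms(2)] add.assoc add.commute add.left_commute)
      finally show ?thesis by (simp only: second_Bianchi[OF assms(2)] add_0_left)
    qed
    have "(\<Sum>b\<in>Basis. (F x *\<^sub>R Q x b y w - cov_Q x y b ?\<xi> w + cov_Q x ?\<xi> b y w) \<bullet> b)
        = F x * (\<Sum>b\<in>Basis. Q x b y w \<bullet> b) - (\<Sum>b\<in>Basis. cov_Q x y b ?\<xi> w \<bullet> b)
          + (\<Sum>b\<in>Basis. cov_Q x ?\<xi> b y w \<bullet> b)"
      by (simp add: inner_add_left inner_diff_left sum.distrib sum_subtractf sum_distrib_left)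
    also have "\<dots> = 0"
      by (simp add: trace[OF assms(2)] trace_cov_Q[OF assms(2) trace])
    finally have "0 = (\<Sum>b\<in>Basis. G x ?\<xi> w * (?d b * (y \<bullet> b)) - G x y w * (?d b * (?\<xi> \<bullet> b))
          + ?d y * (G x b w * (?\<xi> \<bullet> b)) - ?d y * G x ?\<xi> w
          + ?d ?\<xi> * G x y w - ?d ?\<xi> * (G x b w * (y \<bullet> b)))"
      unfolding E by (simp add: inner_add_left inner_diff_left algebra_simps)
    also have "\<dots> = G x ?\<xi> w * (\<Sum>b\<in>Basis. ?d b * (y \<bullet> b)) - G x y w * (\<Sum>b\<in>Basis. ?d b * (?\<xi> \<bullet> b))
        + ?d y * (\<Sum>b\<in>Basis. G x b w * (?\<xi> \<bullet> b)) - DIM('v) * (?d y * G x ?\<xi> w)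
        + DIM('v) * (?d ?\<xi> * G x y w) - ?d ?\<xi> * (\<Sum>b\<in>Basis. G x b w * (y \<bullet> b))"
      by (simp add: sum.distrib sum_subtractf sum_distrib_left[symmetric])
    \<comment> \<open>The rank-one traces leave the factor DIM - 2, nonzero because the dimension is
      at least 3.\<close>
    also have "\<dots> = (real DIM('v) - 2) * (?d ?\<xi> * G x y w - ?d y * G x ?\<xi> w)"
      unfolding trace_rank_one[OF lin] trace_rank_one[OF G_linear(2)[OF assms(2)]]
      by (simp add: algebra_simps)
    finally show ?thesis using dim by simp
  qed
  have "\<exists>y. y \<notin> span {?\<xi>}"
  proof (rule ccontr)
    assume "\<nexists>y. y \<notin> span {?\<xi>}"
    then have "UNIV \<subseteq> span {?\<xi>}" by blast
    then have "dim (UNIV :: 'v set) \<le> card {?\<xi>}" by (rule dim_le_card) simp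
    then show False using dim by simp
  qed
  then obtain y where y: "y \<notin> span {?\<xi>}" ..
  \<comment> \<open>A nonzero vector orthogonal to \<xi>. Inserted twice into \<open>key\<close> it
    kills the derivative along \<xi>; then \<open>key\<close> with \<open>w\<close> equal to \<xi>
    kills all others.\<close>
  define z where "z = y - G x y ?\<xi> *\<^sub>R ?\<xi>"
  have "z \<noteq> 0"
  proof
    assume "z = 0"
    then have "y = G x y ?\<xi> *\<^sub>R ?\<xi>" unfolding z_def by (rule eq_iff_diff_eq_0[THEN iffD2])
    moreover have "G x y ?\<xi> *\<^sub>R ?\<xi> \<in> span {?\<xi>}" by (intro span_scale span_base) simp
    ultimately show False using y by metis
  qed
  then have "G x z z > 0" by (rule G_pos[OF assms(2)])
  moreover have "G x ?\<xi> z = 0"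
    unfolding z_def G_simps[OF assms(2)] G_xi_xi[OF assms(2)] G_sym[OF assms(2), of ?\<xi> y] by simp
  moreover have "?d z * G x ?\<xi> z = ?d ?\<xi> * G x z z" by (rule key)
  ultimately have "?d ?\<xi> = 0" by (metis less_irrefl mult_eq_0_iff mult_zero_right)
  moreover have "?d v * G x ?\<xi> ?\<xi> = ?d ?\<xi> * G x v ?\<xi>" by (rule key)
  ultimately show ?thesis using G_xi_xi[OF assms(2)] by (metis mult.right_neutral mult_zero_left)
qed

end

section \<open>Charts of the manifold\<close>

context smooth_manifold
begin

lemma open_chart_image: "c \<in> A \<Longrightarrow> open (chart_image c)"
  using charts unfolding is_chart_def by blast

lemma topspace_chart: "c \<in> A \<Longrightarrow> topspace (subtopology M (chart_dom c)) = chart_dom c"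
  using charts[of c] unfolding is_chart_def by (simp add: Int_absorb1 openin_subset)

lemma chart_inv_chart_map:
  assumes "c \<in> A" "p \<in> chart_dom c"
  shows "chart_inv c (chart_map c p) = p"
proof -
  have "inj_on (chart_map c) (chart_dom c)"
    using charts[OF assms(1)] homeomorphic_imp_injective_map topspace_chart[OF assms(1)]
    unfolding is_chart_def by metis
  then show ?thesis using assms(2) by (simp add: chart_inv_def)
qed

lemma open_chart_overlap:
  assumes "c \<in> A" "d \<in> A"
  shows "open (chart_map c ` (chart_dom c \<inter> chart_dom d))"
proof -
  have "open_map (subtopology M (chart_dom c)) (top_of_set (chart_image c)) (chart_map c)"
    using charts[OF assms(1)] homeomorphic_imp_open_map unfolding is_chart_def by blast
  moreover have "openin (subtopology M (chart_dom c)) (chart_dom c \<inter> chart_dom d)"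
    using charts[OF assms(2)] unfolding is_chart_def by (simp add: openin_subtopology_Int2)
  ultimately have "openin (top_of_set (chart_image c)) (chart_map c ` (chart_dom c \<inter> chart_dom d))"
    unfolding open_map_def by blast
  then show ?thesis using open_chart_image[OF assms(1)] openin_open_eq by blast
qed

text \<open>On the overlap \<open>local_rep f c\<close> is \<open>local_rep f d\<close> composed
  with the chart change, so this is the chain rule.\<close>

lemma dirderiv_local_rep:
  assumes "smooth_function A f" "c \<in> A" "d \<in> A" "p \<in> chart_dom c \<inter> chart_dom d"
  shows "dirderiv h (local_rep f c) (chart_map c p)
    = dirderiv (jacobian c d p h) (local_rep f d) (chart_map d p)"
proof -
  let ?W = "chart_map c ` (chart_dom c \<inter> chart_dom d)"
  have mem: "chart_map c p \<in> ?W" "chart_map d p \<in> chart_image d"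
    using assms(4) by (auto simp: chart_image_def)
  have change: "chart_change c d (chart_map c q) = chart_map d q" if "q \<in> chart_dom c \<inter> chart_dom d" for q
    using that chart_inv_chart_map[OF assms(2)] by (simp add: chart_change_def)
  have "local_rep f c y = (local_rep f d \<circ> chart_change c d) y" if "y \<in> ?W" for y
    using that change chart_inv_chart_map[OF assms(2)] chart_inv_chart_map[OF assms(3)]
    by (auto simp: local_rep_def)
  then have "dirderiv h (local_rep f c) (chart_map c p)
      = dirderiv h (local_rep f d \<circ> chart_change c d) (chart_map c p)"
    by (rule fun_cong[OF dirderiv_cong[OF open_chart_overlap[OF assms(2,3)] mem(1)]])
  also have "\<dots> = dirderiv (jacobian c d p h) (local_rep f d) (chart_map d p)"
  proof -
    have "(chart_change c d has_derivative jacobian c d p) (at (chart_map c p))"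
      unfolding jacobian_def
      by (rule smooth_on_has_derivative[OF smooth_compatible[OF assms(2,3)] mem(1)])
    moreover have "(local_rep f d has_derivative frechet_derivative (local_rep f d) (at (chart_map d p)))
        (at (chart_change c d (chart_map c p)))"
      using assms(1,3) mem(2) unfolding smooth_function_def change[OF assms(4)]
      by (blast intro: smooth_on_has_derivative)
    ultimately have "(local_rep f d \<circ> chart_change c d has_derivative
        frechet_derivative (local_rep f d) (at (chart_map d p)) \<circ> jacobian c d p) (at (chart_map c p))"
      by (rule diff_chain_at)
    then show ?thesis by (rule dirderiv_eq[THEN trans]) simp
  qed
  finally show ?thesis .
qed

text \<open>The local functions glue to a function on \<open>M\<close> that is constant near every
  point. Preimages of arbitrary sets under it are therefore open, and connectedness leaves a single
  value.\<close>

lemma constant_of_locally_constant: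
  fixes L :: "('a, 'v) chart \<Rightarrow> 'v \<Rightarrow> real"
  assumes deriv: "\<And>c x. c \<in> A \<Longrightarrow> x \<in> chart_image c \<Longrightarrow> (L c has_derivative (\<lambda>_. 0)) (at x)"
    and change: "\<And>c d p. c \<in> A \<Longrightarrow> d \<in> A \<Longrightarrow> p \<in> chart_dom c \<inter> chart_dom d \<Longrightarrow>
      L c (chart_map c p) = L d (chart_map d p)"
  shows "\<exists>k. \<forall>c\<in>A. \<forall>x\<in>chart_image c. L c x = k"
proof -
  define \<Lambda> where "\<Lambda> p = (let c = SOME c. c \<in> A \<and> p \<in> chart_dom c in L c (chart_map c p))" for p
  have \<Lambda>: "\<Lambda> p = L c (chart_map c p)" if "c \<in> A" "p \<in> chart_dom c" for c p
  proof -
    have "(SOME c. c \<in> A \<and> p \<in> chart_dom c) \<in> A \<and> p \<in> chart_dom (SOME c. c \<in> A \<and> p \<in> chart_dom c)"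
      by (rule someI[of _ c]) (use that in simp)
    then show ?thesis unfolding \<Lambda>_def Let_def using that by (intro change) auto
  qed
  have op: "openin M {p \<in> topspace M. \<Lambda> p \<in> B}" for B
  proof (subst openin_subopen, intro ballI)
    fix p assume p: "p \<in> {p \<in> topspace M. \<Lambda> p \<in> B}"
    then obtain c where c: "c \<in> A" "p \<in> chart_dom c" using cover by auto
    then have "chart_map c p \<in> chart_image c" by (simp add: chart_image_def)
    then obtain r where r: "r > 0" "ball (chart_map c p) r \<subseteq> chart_image c"
      using open_chart_image[OF c(1)] openE by blast
    let ?T = "{q \<in> chart_dom c. chart_map c q \<in> ball (chart_map c p) r}"
    have "continuous_map (subtopology M (chart_dom c)) (top_of_set (chart_image c)) (chart_map c)"
      using charts[OF c(1)] homeomorphic_imp_continuous_map unfolding is_chart_def by blast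
    moreover have "openin (top_of_set (chart_image c)) (ball (chart_map c p) r)"
      using r open_chart_image[OF c(1)] by (simp add: openin_open_eq)
    ultimately have "openin (subtopology M (chart_dom c)) ?T"
      by (rule openin_continuous_map_preimage[where X="subtopology M (chart_dom c)",
            unfolded topspace_chart[OF c(1)]])
    moreover have "openin M (chart_dom c)"
      using charts[OF c(1)] unfolding is_chart_def by blast
    ultimately have T: "openin M ?T" by (rule openin_trans_full)
    have "\<Lambda> q = \<Lambda> p" if "q \<in> ?T" for q
    proof -
      \<comment> \<open>A chart image may be disconnected, so a ball, which is convex, is
        used.\<close>
      have "\<exists>k. \<forall>y\<in>ball (chart_map c p) r. L c y = k"
      proof (rule has_derivative_zero_constant)
        show "(L c has_derivative (\<lambda>h. 0)) (at y within ball (chart_map c p) r)"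
          if "y \<in> ball (chart_map c p) r" for y
          by (rule has_derivative_at_withinI[OF deriv[OF c(1) subsetD[OF r(2) that]]])
      qed simp
      then obtain k where "\<And>y. y \<in> ball (chart_map c p) r \<Longrightarrow> L c y = k" by blast
      then have "L c (chart_map c q) = k" "L c (chart_map c p) = k" using that r(1) by simp_all
      then show ?thesis using \<Lambda>[OF c(1)] c(2) that by simp
    qed
    then have "?T \<subseteq> {p \<in> topspace M. \<Lambda> p \<in> B}" using p openin_subset[OF T] by auto
    moreover have "p \<in> ?T" using c r by simp
    ultimately show "\<exists>T. openin M T \<and> p \<in> T \<and> T \<subseteq> {p \<in> topspace M. \<Lambda> p \<in> B}" using T by blast
  qed
  have eq: "\<Lambda> p = \<Lambda> q" if "p \<in> topspace M" "q \<in> topspace M" for p q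
  proof (rule ccontr)
    assume ne: "\<Lambda> p \<noteq> \<Lambda> q"
    show False
    proof (rule connected_spaceD[OF connected op[of "{\<Lambda> p}"] op[of "- {\<Lambda> p}"]])
      show "{r \<in> topspace M. \<Lambda> r \<in> {\<Lambda> p}} \<noteq> {}" using that(1) by auto
      show "{r \<in> topspace M. \<Lambda> r \<in> - {\<Lambda> p}} \<noteq> {}" using that(2) ne by auto
    qed auto
  qed
  \<comment> \<open>Any point of \<open>M\<close> can supply the constant; if \<open>M\<close> is
    empty there is no \<open>x\<close> to consider.\<close>
  have "L c x = \<Lambda> (SOME p. p \<in> topspace M)" if c: "c \<in> A" and x: "x \<in> chart_image c" for c x
  proof -
    obtain p where p: "p \<in> chart_dom c" "x = chart_map c p"
      using x unfolding chart_image_def by blast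
    then have "p \<in> topspace M" using cover c by blast
    then have "\<Lambda> p = \<Lambda> (SOME p. p \<in> topspace M)" by (metis eq someI)
    then show ?thesis using \<Lambda>[OF c p(1)] p(2) by simp
  qed
  then show ?thesis by blast
qed

end

lemma (in riemannian_manifold) coordinate_metric_chart:
  assumes "c \<in> A" shows "coordinate_metric (chart_image c) (g c) (nabla c)"
proof
  note m = metric[unfolded riemannian_metric_def, THEN conjunct1, rule_format, OF assms]
  show "open (chart_image c)" by (rule open_chart_image[OF assms])
  show "levi_civita_on (chart_image c) (g c) (nabla c)" by (rule levi_civita[OF assms])
  show "smooth_on (\<lambda>x. g c x u v) (chart_image c)" for u v using m by blast
  fix x assume x: "x \<in> chart_image c"
  show "bilinear (g c x)" "g c x u v = g c x v u" "u \<noteq> 0 \<Longrightarrow> g c x u u > 0" for u v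
    using m x by blast+
qed

section \<open>The structure vector field of a Kenmotsu manifold\<close>

context f_Kenmotsu_manifold
begin

text \<open>The structure equation with \<open>Y\<close> equal to \<xi> determines \<phi> of the
  derivative of \<xi>. Applying \<phi> again recovers that derivative up to its \<xi>-component,
  which vanishes since \<xi> has unit length.\<close>

lemma kenmotsu_chart:
  assumes c: "c \<in> A"
  shows "kenmotsu_chart (chart_image c) (g c) (nabla c) (\<xi> c) (local_rep f c)"
proof -
  interpret coordinate_metric "chart_image c" "g c" "nabla c"
    by (rule coordinate_metric_chart[OF c])
  have \<xi>: "smooth_on (\<xi> c) (chart_image c)"
    using vector_field_\<xi> c unfolding vector_field_def by blast
  have unit: "g c x (\<xi> c x) (\<xi> c x) = 1" if "x \<in> chart_image c" for x
    using \<eta>_eq[OF c that] \<eta>_\<xi>[OF c that] by metis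
  show ?thesis
  proof
    show "smooth_on (\<xi> c) (chart_image c)" by (rule \<xi>)
    show "smooth_on (local_rep f c) (chart_image c)"
      using smooth_f c unfolding smooth_function_def by blast
    fix x a assume x: "x \<in> chart_image c"
    show "g c x (\<xi> c x) (\<xi> c x) = 1" by (rule unit[OF x])
    \<comment> \<open>The wedge condition is evaluated on \<open>a\<close> and \<xi>, where \<eta>
      takes the value 1 on \<xi>.\<close>
    show "dirderiv a (local_rep f c) x
        = dirderiv (\<xi> c x) (local_rep f c) x * g c x a (\<xi> c x)"
      using df_wedge_\<eta>[OF c x, of a "\<xi> c x"] \<eta>_\<xi>[OF c x] \<eta>_eq[OF c x, of a] by simp
    let ?F = "local_rep f c x" and ?N = "cov a (\<xi> c) x"
    have "linear (\<phi> c x)"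
      using endomorphism_field_\<phi> c x unfolding endomorphism_field_def by blast
    note \<phi>_lin = linear_scale[OF this] linear_neg[OF this]
    have z: "cov a (\<lambda>_. 0) x = 0"
      using christoffel_simps(7)[OF x, of a] unfolding christoffel_def .
    have "cov a (\<lambda>_. 0) x = cov a (\<lambda>y. \<phi> c y (\<xi> c y)) x"
      by (rule cov_cong) (simp_all add: \<phi>_\<xi>[OF c] smooth_on_const x)
    then have "- \<phi> c x ?N = ?F *\<^sub>R (- \<phi> c x a)"
      using Kenmotsu[OF c smooth_on_const \<xi> x, of a] z \<eta>_\<xi>[OF c x] \<eta>_\<phi>[OF c x, of a]
        \<eta>_eq[OF c x, of "\<phi> c x a"] by simp
    then have "\<phi> c x ?N = ?F *\<^sub>R \<phi> c x a" by simp
    then have "\<phi> c x (\<phi> c x ?N) = ?F *\<^sub>R \<phi> c x (\<phi> c x a)" by (simp add: \<phi>_lin)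
    moreover have "\<eta> c x ?N = 0"
    proof -
      have "0 = dirderiv a (\<lambda>_. 1) x" by simp
      also have "\<dots> = dirderiv a (\<lambda>y. g c y (\<xi> c y) (\<xi> c y)) x"
        by (rule fun_cong[OF dirderiv_cong[OF open_U x]]) (simp add: unit)
      also have "\<dots> = 2 * g c x ?N (\<xi> c x)"
        using dirderiv_G[OF \<xi> \<xi> x, of a] G_sym[OF x, of "\<xi> c x" ?N] by simp
      finally show ?thesis using \<eta>_eq[OF c x] by simp
    qed
    ultimately have "- ?N = ?F *\<^sub>R (- a + \<eta> c x a *\<^sub>R \<xi> c x)"
      by (simp add: \<phi>_\<phi>[OF c x])
    then have "?N = - (?F *\<^sub>R (- a + \<eta> c x a *\<^sub>R \<xi> c x))" by (metis minus_minus)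
    then show "?N = ?F *\<^sub>R (a - g c x a (\<xi> c x) *\<^sub>R \<xi> c x)"
      unfolding \<eta>_eq[OF c x] by (simp add: algebra_simps)
  qed
qed

end

section \<open>From the charts to the manifold: the Einstein condition\<close>

context regular_f_Kenmotsu_manifold
begin

abbreviation (input) lam_chart :: "('a, 'v) chart \<Rightarrow> 'v \<Rightarrow> real" where
  "lam_chart c \<equiv> kenmotsu_chart.lam (\<xi> c) (local_rep f c)"

lemma lam_chart_eq:
  assumes "c \<in> A"
  shows "lam_chart c x = (local_rep f c x)\<^sup>2 + deriv_along (\<xi> c) (local_rep f c) x"
  using kenmotsu_chart.lam_def[OF kenmotsu_chart[OF assms]] by (simp add: deriv_along_def)

text \<open>\<lambda> is a scalar: the Jacobian in the transformation of \<xi> is the one that the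
  chain rule produces for the derivative of \<open>f\<close>.\<close>

lemma lam_chart_change:
  assumes "c \<in> A" "d \<in> A" "p \<in> chart_dom c \<inter> chart_dom d"
  shows "lam_chart c (chart_map c p) = lam_chart d (chart_map d p)"
proof -
  have "\<xi> d (chart_map d p) = jacobian c d p (\<xi> c (chart_map c p))"
    using vector_field_\<xi> assms unfolding vector_field_def by blast
  moreover have "local_rep f c (chart_map c p) = local_rep f d (chart_map d p)"
    using assms by (simp add: local_rep_def chart_inv_chart_map)
  ultimately show ?thesis
    unfolding lam_chart_eq[OF assms(1)] lam_chart_eq[OF assms(2)] deriv_along_def
    by (simp add: dirderiv_local_rep[OF smooth_f assms])
qed

lemma Einstein_of_Ricci_semisymmetric:
  assumes "Ricci_semisymmetric A nabla"
  shows "Einstein A g nabla"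
proof -
  have ricci: "ricci (nabla c) x v w = - ((DIM('v) - 1) * lam_chart c x * g c x v w)"
    if c: "c \<in> A" and x: "x \<in> chart_image c" for c x v w
  proof (rule kenmotsu_chart.ricci_of_semisymmetric[OF kenmotsu_chart[OF c] x])
    show "lam_chart c x \<noteq> 0" using regular[OF c x] lam_chart_eq[OF c] by simp
    show "ricci (nabla c) x (curvature (nabla c) x u v w1) w2
        + ricci (nabla c) x w1 (curvature (nabla c) x u v w2) = 0" for u v w1 w2
    proof -
      have "- ricci (nabla c) x (curvature (nabla c) x u v w1) w2
          - ricci (nabla c) x w1 (curvature (nabla c) x u v w2) = 0"
        using assms c x unfolding Ricci_semisymmetric_def Let_def by blast
      then show ?thesis by linarith
    qed
  qed
  have "\<exists>k. \<forall>c\<in>A. \<forall>x\<in>chart_image c. lam_chart c x = k"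
  proof (rule constant_of_locally_constant)
    show "(lam_chart c has_derivative (\<lambda>_. 0)) (at x)" if c: "c \<in> A" and x: "x \<in> chart_image c" for c x
    proof -
      interpret kenmotsu_chart "chart_image c" "g c" "nabla c" "\<xi> c" "local_rep f c"
        by (rule kenmotsu_chart[OF c])
      have "dirderiv h (lam_chart c) x = 0" for h
      proof (rule dirderiv_lam_zero[OF _ x])
        show "DIM('v) \<ge> 3" using dimension n_ge_1 by simp
        \<comment> \<open>Semisymmetry enters the Schur argument here: the Ricci formula just proved
          makes \<open>Q\<close> trace free.\<close>
        show "(\<Sum>b\<in>Basis. Q y b v w \<bullet> b) = 0" if "y \<in> chart_image c" for y v w
          unfolding trace_Q[OF that] ricci[OF c that] by simp
      qed
      then have "frechet_derivative (lam_chart c) (at x) = (\<lambda>_. 0)" by blast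
      then show ?thesis using smooth_on_has_derivative[OF lam_smooth x] by simp
    qed
  qed (rule lam_chart_change)
  then obtain k where "\<And>c x. c \<in> A \<Longrightarrow> x \<in> chart_image c \<Longrightarrow> lam_chart c x = k" by blast
  then have "ricci (nabla c) x v w = - ((DIM('v) - 1) * k) * g c x v w"
    if "c \<in> A" "x \<in> chart_image c" for c x v w
    using ricci[OF that, of v w] that by simp
  then show ?thesis unfolding Einstein_def by blast
qed

lemma Ricci_semisymmetric_of_semisymmetric:
  assumes "semisymmetric A nabla"
  shows "Ricci_semisymmetric A nabla"
proof -
  have "- ricci (nabla c) x (curvature (nabla c) x u v w1) w2
        - ricci (nabla c) x w1 (curvature (nabla c) x u v w2) = 0"
    if "c \<in> A" "x \<in> chart_image c" for c x u v w1 w2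
  proof -
    have "ricci (nabla c) x (curvature (nabla c) x u v w1) w2
        + ricci (nabla c) x w1 (curvature (nabla c) x u v w2) = 0"
      using assms that unfolding semisymmetric_def Let_def
      by (intro coordinate_metric.ricci_semisymmetric_of_semisymmetric[OF coordinate_metric_chart]) auto
    then show ?thesis by linarith
  qed
  then show ?thesis unfolding Ricci_semisymmetric_def Let_def by blast
qed

end

theorem proposition1:
  fixes M :: "'a topology"
    and A :: "('a, 'v::euclidean_space) chart set"
    and g :: "('a, 'v) chart \<Rightarrow> 'v \<Rightarrow> 'v \<Rightarrow> 'v \<Rightarrow> real"
    and nabla :: "('a, 'v) chart \<Rightarrow> ('v \<Rightarrow> 'v) \<Rightarrow> ('v \<Rightarrow> 'v) \<Rightarrow> 'v \<Rightarrow> 'v"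
    and n :: nat
    and \<phi> :: "('a, 'v) chart \<Rightarrow> 'v \<Rightarrow> 'v \<Rightarrow> 'v"
    and \<xi> :: "('a, 'v) chart \<Rightarrow> 'v \<Rightarrow> 'v"
    and \<eta> :: "('a, 'v) chart \<Rightarrow> 'v \<Rightarrow> 'v \<Rightarrow> real"
    and f :: "'a \<Rightarrow> real"
  assumes "regular_f_Kenmotsu_manifold M A g nabla n \<phi> \<xi> \<eta> f"
    and "Ricci_semisymmetric A nabla \<or> semisymmetric A nabla"
  shows "Einstein A g nabla"
proof -
  interpret regular_f_Kenmotsu_manifold M A g nabla n \<phi> \<xi> \<eta> f by (rule assms(1))
  show ?thesis
    using assms(2) Einstein_of_Ricci_semisymmetric Ricci_semisymmetric_of_semisymmetric by blast
qed

end
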